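(* Let $p\ge 1$ and $n_1,\dots,n_p\ge 1$ be integers, $n=n_1+\cdots+n_p$, and let $A=(A_{[ab]})_{1\le a,b\le p}$ be an $n\times n$ matrix in block form with entries in a field of characteristic $0$, the block $A_{[ab]}$ having size $n_a\times n_b$. Assume that for each $a\in\{1,\dots,p\}$ the diagonal block $A_{[aa]}$ is of the form $z_aI_{n_a}$ for some scalar $z_a$. Then $$\det A=\sum_{\mathsf{C}\in\mathcal{C}_{\le\underline{n}}}\frac{\underline{z}^{\underline{n}-\underline{v}(\mathsf{C})}}{\mathsf{C}!}\prod_{\mathsf{c}\in\mathsf{C}}\frac{(-1)^{|\mathsf{c}|-1}\operatorname{Tr}(A_{\mathsf{c}})}{\operatorname{val}(\mathsf{c})},$$ where the product over $\mathsf{c}\in\mathsf{C}$ takes multiplicities into account.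
   Context: A cyclic walk on $\{1,\dots,p\}$ is a cyclically ordered list $\mathsf{c}=(\!(a_1,\dots,a_k)\!)$ of length $|\mathsf{c}|=k\ge2$ of elements of $\{1,\dots,p\}$ in which any two successive elements are distinct ($a_1\ne a_2,\dots,a_{k-1}\neq a_k,a_k\neq a_1$); i.e. the orbit of such a $k$-tuple under cyclic shifts by $\mathbb{Z}/k\mathbb{Z}$. An element may be visited several times. Its valuation $\operatorname{val}(\mathsf{c})$ is the order of the stabiliser in $\mathbb{Z}/k\mathbb{Z}$ of $(a_1,\dots,a_k)$. The number of visits at $a$ is $v_a(\mathsf{c})=|\{i:a_i=a\}|$. For a finite multiset $\mathsf{C}$ of cyclic walks, $v_a(\mathsf{C})=\sum_{\mathsf{c}\in\mathsf{C}}v_a(\mathsf{c})$ (with multiplicities), and $\mathsf{C}!$ is the product of the factorials of the multiplicities of the elements of $\mathsf{C}$. $\mathcal{C}_{\le\underline{n}}$ is the set of multisets $\mathsf{C}$ of cyclic walks on $\{1,\dots,p\}$ such that $v_a(\mathsf{C})\le n_a$ for all $a$; it includes the empty multiset, whose contribution is $\underline{z}^{\underline{n}}$. Moreover $\underline{z}^{\underline{n}-\underline{v}(\mathsf{C})}=\prod_{a=1}^pz_a^{n_a-v_a(\mathsf{C})}$ (with $z^0=1$), and $\operatorname{Tr}(A_{\mathsf{c}})=\operatorname{Tr}(A_{[a_1a_2]}A_{[a_2a_3]}\cdots A_{[a_ka_1]})$, which does not depend on the choice of starting point. *)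

theory Defs
  imports "Jordan_Normal_Form.Determinant" "HOL-Library.Multiset"
begin

section \<open>Cyclic walks\<close>

definition closed_walks :: "nat \<Rightarrow> nat list set" where
  "closed_walks p = {as. length as \<ge> 2 \<and> set as \<subseteq> {1..p} \<and>
     (\<forall>i < length as. as ! i \<noteq> as ! (Suc i mod length as))}"

definition cyc_orbit :: "'b list \<Rightarrow> 'b list set" where
  "cyc_orbit as = {rotate m as | m. m < length as}"

text \<open>A cyclic walk is the whole orbit of a tuple under cyclic shifts.\<close>

definition cyclic_walks :: "nat \<Rightarrow> nat list set set" where
  "cyclic_walks p = cyc_orbit ` closed_walks p"

text \<open>The functions of a cyclic walk below are evaluated at an arbitrary element of the orbit;
  lemmas \<open>cyc_length_orbit\<close>, \<open>cyc_val_orbit\<close>, \<open>cyc_visits_orbit\<close> and \<open>cyc_trace_orbit\<close>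
  show that the choice does not matter.\<close>

definition cyc_rep :: "'b list set \<Rightarrow> 'b list" where
  "cyc_rep c = (SOME as. as \<in> c)"

definition cyc_length :: "'b list set \<Rightarrow> nat" where
  "cyc_length c = length (cyc_rep c)"

definition list_val :: "'b list \<Rightarrow> nat" where
  "list_val as = card {m. m < length as \<and> rotate m as = as}"

definition cyc_val :: "'b list set \<Rightarrow> nat" where
  "cyc_val c = list_val (cyc_rep c)"

definition cyc_visits :: "'b list set \<Rightarrow> 'b \<Rightarrow> nat" where
  "cyc_visits c a = count_list (cyc_rep c) a"

section \<open>Multisets of cyclic walks\<close>

definition mset_visits :: "'b list set multiset \<Rightarrow> 'b \<Rightarrow> nat" where
  "mset_visits C a = (\<Sum>c\<in>#C. cyc_visits c a)"

definition mset_fact :: "'b multiset \<Rightarrow> nat" where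
  "mset_fact C = (\<Prod>c\<in>set_mset C. fact (count C c))"

definition walk_msets :: "nat \<Rightarrow> (nat \<Rightarrow> nat) \<Rightarrow> nat list set multiset set" where
  "walk_msets p ns = {C. set_mset C \<subseteq> cyclic_walks p \<and> (\<forall>a\<in>{1..p}. mset_visits C a \<le> ns a)}"

section \<open>Block matrices\<close>

text \<open>Matrix indices start at 0, block indices at 1: block \<open>a\<close> occupies the \<open>ns a\<close> indices
  following the first \<open>ns 1 + \<dots> + ns (a - 1)\<close> ones.\<close>

definition block_offset :: "(nat \<Rightarrow> nat) \<Rightarrow> nat \<Rightarrow> nat" where
  "block_offset ns a = (\<Sum>b = 1..<a. ns b)"

definition block :: "(nat \<Rightarrow> nat) \<Rightarrow> 'a mat \<Rightarrow> nat \<Rightarrow> nat \<Rightarrow> 'a mat" where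
  "block ns A a b = mat (ns a) (ns b)
     (\<lambda>(i, j). A $$ (block_offset ns a + i, block_offset ns b + j))"

definition mat_trace :: "'a::comm_monoid_add mat \<Rightarrow> 'a" where
  "mat_trace M = (\<Sum>i < dim_row M. M $$ (i, i))"

text \<open>The product of the blocks along an open path; it is taken along
  \<open>a\<^sub>1, \<dots>, a\<^sub>k, a\<^sub>1\<close> for a closed walk.\<close>

fun path_prod :: "(nat \<Rightarrow> nat) \<Rightarrow> 'a::comm_ring_1 mat \<Rightarrow> nat list \<Rightarrow> 'a mat" where
  "path_prod ns A [] = 1\<^sub>m 0"
| "path_prod ns A [a] = 1\<^sub>m (ns a)"
| "path_prod ns A (a # b # as) = block ns A a b * path_prod ns A (b # as)"

definition list_trace :: "(nat \<Rightarrow> nat) \<Rightarrow> 'a::comm_ring_1 mat \<Rightarrow> nat list \<Rightarrow> 'a" where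
  "list_trace ns A as = mat_trace (path_prod ns A (as @ [hd as]))"

definition cyc_trace :: "(nat \<Rightarrow> nat) \<Rightarrow> 'a::comm_ring_1 mat \<Rightarrow> nat list set \<Rightarrow> 'a" where
  "cyc_trace ns A c = list_trace ns A (cyc_rep c)"

section \<open>Well-definedness\<close>

lemma cyc_rep_orbit:
  assumes "as \<noteq> []"
  obtains m where "m < length as" "cyc_rep (cyc_orbit as) = rotate m as"
proof -
  have "rotate 0 as \<in> cyc_orbit as"
    using assms unfolding cyc_orbit_def by blast
  then have "cyc_rep (cyc_orbit as) \<in> cyc_orbit as"
    unfolding cyc_rep_def by (rule someI)
  then show ?thesis using that unfolding cyc_orbit_def by auto
qed

lemma cyc_orbit_inv:
  assumes "as \<noteq> []" and step: "\<And>bs. bs \<noteq> [] \<Longrightarrow> f (rotate1 bs) = f bs"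
  shows "f (cyc_rep (cyc_orbit as)) = f as"
proof -
  have "f (rotate m as) = f as" for m
    by (induction m) (simp_all add: step assms(1))
  then show ?thesis using cyc_rep_orbit[OF assms(1)] by metis
qed

lemma cyc_length_orbit: "as \<noteq> [] \<Longrightarrow> cyc_length (cyc_orbit as) = length as"
  unfolding cyc_length_def by (rule cyc_orbit_inv[where f = length]) auto

lemma list_val_rotate1: "list_val (rotate1 bs) = list_val bs"
proof -
  have "rotate m (rotate1 bs) = rotate1 bs \<longleftrightarrow> rotate m bs = bs" for m
    using inj_rotate1[THEN inj_eq] by (metis rotate1_rotate_swap)
  then show ?thesis unfolding list_val_def by simp
qed

lemma cyc_val_orbit: "as \<noteq> [] \<Longrightarrow> cyc_val (cyc_orbit as) = list_val as"
  unfolding cyc_val_def by (rule cyc_orbit_inv[where f = list_val]) (simp_all add: list_val_rotate1)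

lemma count_list_rotate1: "count_list (rotate1 bs) a = count_list bs a"
  by (cases bs) auto

lemma cyc_visits_orbit: "as \<noteq> [] \<Longrightarrow> cyc_visits (cyc_orbit as) a = count_list as a"
  unfolding cyc_visits_def
  by (rule cyc_orbit_inv[where f = "\<lambda>bs. count_list bs a"]) (simp_all add: count_list_rotate1)

lemma mat_trace_comm:
  fixes A B :: "'a::comm_ring_1 mat"
  assumes "A \<in> carrier_mat r c" "B \<in> carrier_mat c r"
  shows "mat_trace (A * B) = mat_trace (B * A)"
proof -
  have "mat_trace (A * B) = (\<Sum>i<r. \<Sum>k<c. A $$ (i, k) * B $$ (k, i))"
    using assms by (auto simp: mat_trace_def scalar_prod_def atLeast0LessThan intro!: sum.cong)
  also have "\<dots> = (\<Sum>k<c. \<Sum>i<r. A $$ (i, k) * B $$ (k, i))"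
    by (rule sum.swap)
  also have "\<dots> = mat_trace (B * A)"
    using assms
    by (auto simp: mat_trace_def scalar_prod_def atLeast0LessThan mult.commute intro!: sum.cong)
  finally show ?thesis .
qed

lemma block_carrier [simp]: "block ns A a b \<in> carrier_mat (ns a) (ns b)"
  by (simp add: block_def)

lemma path_prod_carrier:
  "as \<noteq> [] \<Longrightarrow> path_prod ns A as \<in> carrier_mat (ns (hd as)) (ns (last as))"
proof (induction ns A as rule: path_prod.induct)
  case (3 ns A a b as)
  then show ?case using mult_carrier_mat[OF block_carrier] by fastforce
qed auto

lemma path_prod_snoc:
  "path_prod ns A (as @ [a, b]) = path_prod ns A (as @ [a]) * block ns A a b"
proof (induction as)
  case Nil
  show ?case
    by (simp add: left_mult_one_mat[OF block_carrier] right_mult_one_mat[OF block_carrier])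
next
  case (Cons x xs)
  obtain y ys where y: "xs @ [a] = y # ys" by (cases xs) auto
  then have y': "xs @ [a, b] = y # ys @ [b]" by (metis append.assoc append_Cons append_Nil)
  have l: "last (y # ys) = a" using y by (metis last_snoc)
  have "path_prod ns A ((x # xs) @ [a, b]) = block ns A x y * path_prod ns A (xs @ [a, b])"
    by (simp add: y')
  also have "\<dots> = block ns A x y * (path_prod ns A (y # ys) * block ns A a b)"
    by (simp add: Cons.IH flip: y)
  also have "\<dots> = block ns A x y * path_prod ns A (y # ys) * block ns A a b"
    using assoc_mult_mat[OF block_carrier _ block_carrier] path_prod_carrier[of "y # ys" ns A] l
    by (metis list.sel(1) list.discI)
  finally show ?case by (simp add: y)
qed

lemma list_trace_rotate1:
  assumes "bs \<noteq> []"
  shows "list_trace ns A (rotate1 bs) = list_trace ns A bs"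
proof (cases bs)
  case (Cons x xs)
  show ?thesis
  proof (cases xs)
    case (Cons y ys)
    have c: "path_prod ns A (y # ys @ [x]) \<in> carrier_mat (ns y) (ns x)"
      using path_prod_carrier[of "y # ys @ [x]" ns A] by simp
    have "list_trace ns A (rotate1 bs) = mat_trace (path_prod ns A ((y # ys) @ [x, y]))"
      using \<open>bs = x # xs\<close> Cons by (simp add: list_trace_def)
    also have "\<dots> = mat_trace (path_prod ns A (y # ys @ [x]) * block ns A x y)"
      by (subst path_prod_snoc) simp
    also have "\<dots> = mat_trace (block ns A x y * path_prod ns A (y # ys @ [x]))"
      by (rule mat_trace_comm[OF c block_carrier[of ns A x y]])
    also have "\<dots> = list_trace ns A bs"
      using \<open>bs = x # xs\<close> Cons by (simp add: list_trace_def)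
    finally show ?thesis .
  qed (use \<open>bs = x # xs\<close> in simp)
qed (use assms in simp)

lemma cyc_trace_orbit: "as \<noteq> [] \<Longrightarrow> cyc_trace ns A (cyc_orbit as) = list_trace ns A as"
  unfolding cyc_trace_def
  by (rule cyc_orbit_inv[where f = "list_trace ns A"]) (simp_all add: list_trace_rotate1)

lemma cyc_length_eq_sum_visits:
  assumes "c \<in> cyclic_walks p"
  shows "cyc_length c = (\<Sum>a = 1..p. cyc_visits c a)"
proof -
  obtain as where "c = cyc_orbit as" "as \<in> closed_walks p"
    using assms by (auto simp: cyclic_walks_def)
  then have as: "c = cyc_orbit as" "as \<noteq> []" "set as \<subseteq> {1..p}"
    by (auto simp: closed_walks_def)
  have "length as = (\<Sum>a \<in> {1..p}. count_list as a)"
    using sum_count_set[OF as(3)] by simp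
  then show ?thesis by (simp add: as cyc_length_orbit cyc_visits_orbit)
qed

lemma finite_walk_msets: "finite (walk_msets p ns)"
proof -
  define N where "N = (\<Sum>a = 1..p. ns a)"
  define L where "L = {as. set as \<subseteq> {1..p} \<and> length as \<le> N}"
  have finL: "finite L" unfolding L_def by (rule finite_lists_length_le) simp
  have "walk_msets p ns \<subseteq> (\<Union>n\<le>N. multisets_of_size (cyc_orbit ` L) n)"
  proof
    fix C assume C: "C \<in> walk_msets p ns"
    then have W: "set_mset C \<subseteq> cyclic_walks p" by (simp add: walk_msets_def)
    have "(\<Sum>c\<in>#C. cyc_length c) = (\<Sum>c\<in>#C. \<Sum>a = 1..p. cyc_visits c a)"
      using W by (intro arg_cong[where f = sum_mset] image_mset_cong cyc_length_eq_sum_visits) auto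
    also have "\<dots> = (\<Sum>a = 1..p. mset_visits C a)"
      unfolding mset_visits_def by (induction C) (simp_all add: sum.distrib)
    also have "\<dots> \<le> N"
      unfolding N_def using C by (intro sum_mono) (auto simp: walk_msets_def)
    finally have le: "(\<Sum>c\<in>#C. cyc_length c) \<le> N" .
    have pos: "1 \<le> cyc_length c" if c: "c \<in># C" for c
    proof -
      obtain as where "c = cyc_orbit as" "as \<in> closed_walks p"
        using W c unfolding cyclic_walks_def by blast
      moreover from this have "length as \<ge> 2" by (simp add: closed_walks_def)
      moreover from this have "as \<noteq> []" by force
      ultimately show ?thesis by (simp add: cyc_length_orbit)
    qed
    have "size C = (\<Sum>c\<in>#C. 1)" by (rule size_eq_sum_mset)
    also have "\<dots> \<le> (\<Sum>c\<in>#C. cyc_length c)" by (rule sum_mset_mono) (rule pos)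
    finally have "size C \<le> N" using le by linarith
    moreover have "c \<in> cyc_orbit ` L" if c: "c \<in># C" for c
    proof -
      obtain as where as: "c = cyc_orbit as" "as \<in> closed_walks p"
        using W c unfolding cyclic_walks_def by blast
      have "as \<noteq> []" using as by (auto simp: closed_walks_def)
      obtain D where "C = add_mset c D" using multi_member_split[OF c] by blast
      then have "cyc_length c \<le> (\<Sum>c\<in>#C. cyc_length c)" by simp
      then have "length as \<le> N" using le \<open>as \<noteq> []\<close> by (simp add: as(1) cyc_length_orbit)
      then have "as \<in> L" using as(2) by (simp add: L_def closed_walks_def)
      then show ?thesis using as(1) by blast
    qed
    ultimately show "C \<in> (\<Union>n\<le>N. multisets_of_size (cyc_orbit ` L) n)"
      unfolding multisets_of_size_def by auto
  qed
  then show ?thesis by (rule finite_subset) (use finL in auto)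
qed

end

theory Submission
  imports Defs
begin

text \<open>
  Write \<open>A = Z + B\<close>, where \<open>Z\<close> is the block diagonal part and \<open>B\<close> the rest, and let \<open>T\<close> be the diagonal
  matrix with a free scalar \<open>t a\<close> on block \<open>a\<close>. Formally,
  \<open>det (1 + T B) = exp (Tr (log (1 + T B))) = exp (\<Sum>k. (-1)\<^bsup>k-1\<^esup> Tr ((T B)\<^sup>k) / k)\<close>.
  The trace of \<open>(T B)\<^sup>k\<close> is the sum over closed walks of length \<open>k\<close> of a monomial in \<open>t\<close>, which counts
  visits, times the trace of the product of blocks along the walk. A cyclic walk \<open>c\<close> is an
  orbit of \<open>k / val c\<close> closed walks, which replaces \<open>1 / k\<close> by \<open>1 / val c\<close>; expanding the exponential gives
  a sum over multisets of cyclic walks with the factorials of multiplicities in the denominators.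

  The exponential is handled without formal series. Introducing a variable \<open>s\<close> that counts length,
  the coefficients of both sides satisfy the same recursion: Newton's identities
  (\<open>newton_identity\<close>) for \<open>det (1 + s T B)\<close>, and the logarithmic derivative of an exponential
  (\<open>exp_coeff_recursion\<close>) for the sum over multisets. Lemma \<open>minor_sum_eq_exp_coeff\<close> concludes that they
  agree.

  To pass from \<open>1 + T B\<close> to \<open>Z + B\<close> without dividing by \<open>z\<close>, note that by the Leibniz formula
  \<open>det (Z + T B)\<close> is a sum of monomials in which the exponents of \<open>z a\<close> and \<open>t a\<close> add up to \<open>ns a\<close>
  (\<open>det_scaled_blocks\<close>). Its coefficients can therefore be read off at \<open>z = 1\<close>, where they are given
  by the multisets of walks. This comparison of coefficients in \<open>t\<close>
  (\<open>multivariate_coefficients_determined\<close>) also shows that the contributions of multisets with the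
  same numbers of visits cancel out as soon as some block \<open>a\<close> is visited more than \<open>ns a\<close> times.
\<close>

section \<open>Newton's identities for a matrix\<close>

text \<open>Jacobi's formula. The product rule applied to the Leibniz expansion differentiates one row at a
  time; expanding each of the resulting determinants along the differentiated row brings in only
  cofactors of the original matrix.\<close>

lemma pderiv_det:
  fixes M :: "'a::idom poly mat"
  assumes M: "M \<in> carrier_mat n n"
  shows "pderiv (det M) = (\<Sum>i<n. \<Sum>j<n. pderiv (M $$ (i, j)) * cofactor M i j)"
proof -
  define R where "R i = mat n n (\<lambda>(k, j). if k = i then pderiv (M $$ (i, j)) else M $$ (k, j))" for i
  have R: "R i \<in> carrier_mat n n" for i by (simp add: R_def)
  let ?P = "{\<pi>. \<pi> permutes {0..<n}}"
  have "pderiv (det M) = (\<Sum>\<pi>\<in>?P. signof \<pi> * pderiv (\<Prod>i = 0..<n. M $$ (i, \<pi> i)))"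
  proof -
    have "pderiv (signof \<pi> * q) = signof \<pi> * pderiv q" for \<pi> and q :: "'a poly"
      by (cases \<pi> rule: sign_cases) (simp_all add: pderiv_minus)
    moreover have "pderiv (\<Sum>\<pi>\<in>?P. q \<pi>) = (\<Sum>\<pi>\<in>?P. pderiv (q \<pi>))" for q :: "_ \<Rightarrow> 'a poly"
      using sum_comp_morphism[of pderiv q ?P] by (simp add: pderiv_add o_def)
    ultimately show ?thesis by (simp add: det_def'[OF M])
  qed
  also have "\<dots> = (\<Sum>\<pi>\<in>?P. \<Sum>i = 0..<n. signof \<pi> * (\<Prod>k = 0..<n. R i $$ (k, \<pi> k)))"
  proof (rule sum.cong[OF refl])
    fix \<pi> assume \<pi>: "\<pi> \<in> ?P"
    have "pderiv (\<Prod>i = 0..<n. M $$ (i, \<pi> i)) = (\<Sum>i = 0..<n. \<Prod>k = 0..<n. R i $$ (k, \<pi> k))"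
      unfolding pderiv_prod
    proof (rule sum.cong[OF refl])
      fix i assume i: "i \<in> {0..<n}"
      have pk: "k < n \<Longrightarrow> \<pi> k < n" for k using permutes_in_image[of \<pi> "{0..<n}" k] \<pi> by auto
      show "(\<Prod>k\<in>{0..<n} - {i}. M $$ (k, \<pi> k)) * pderiv (M $$ (i, \<pi> i))
          = (\<Prod>k = 0..<n. R i $$ (k, \<pi> k))"
        using i pk by (simp add: prod.remove[of _ i] R_def mult.commute)
    qed
    then show "signof \<pi> * pderiv (\<Prod>i = 0..<n. M $$ (i, \<pi> i))
        = (\<Sum>i = 0..<n. signof \<pi> * (\<Prod>k = 0..<n. R i $$ (k, \<pi> k)))"
      by (simp add: sum_distrib_left)
  qed
  also have "\<dots> = (\<Sum>i<n. det (R i))"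
    by (subst sum.swap) (simp add: det_def'[OF R] atLeast0LessThan)
  also have "\<dots> = (\<Sum>i<n. \<Sum>j<n. pderiv (M $$ (i, j)) * cofactor M i j)"
  proof (rule sum.cong[OF refl])
    fix i assume i: "i \<in> {..<n}"
    have "mat_delete (R i) i j = mat_delete M i j" if "j < n" for j
      using M i that by (intro eq_matI) (auto simp: mat_delete_def R_def)
    then show "det (R i) = (\<Sum>j<n. pderiv (M $$ (i, j)) * cofactor M i j)"
      using i by (subst laplace_expansion_row[OF R, of i])
        (auto simp: cofactor_def R_def intro!: sum.cong)
  qed
  finally show ?thesis .
qed

text \<open>The polynomial matrix \<open>1 + s X\<close> in the indeterminate \<open>s\<close>.\<close>

definition one_plus_sX :: "'a::comm_ring_1 mat \<Rightarrow> 'a poly mat" where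
  "one_plus_sX X = mat (dim_row X) (dim_col X)
     (\<lambda>(i, j). [:if i = j then 1 else 0, X $$ (i, j):])"

text \<open>The coefficients of \<open>det (1 + s X)\<close> are the sums of the principal minors of a given order,
  equivalently the elementary symmetric functions of the eigenvalues of \<open>X\<close>.\<close>

definition minor_sum :: "'a::comm_ring_1 mat \<Rightarrow> nat \<Rightarrow> 'a" where
  "minor_sum X N = coeff (det (one_plus_sX X)) N"

definition power_trace :: "'a::comm_ring_1 mat \<Rightarrow> nat \<Rightarrow> 'a" where
  "power_trace X k = mat_trace (X ^\<^sub>m k)"

lemma mat_trace_add:
  "A \<in> carrier_mat n n \<Longrightarrow> B \<in> carrier_mat n n \<Longrightarrow> mat_trace (A + B) = mat_trace A + mat_trace B"
  by (auto simp: mat_trace_def sum.distrib)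

lemma mat_trace_smult:
  fixes A :: "'a::comm_ring_1 mat"
  shows "A \<in> carrier_mat n n \<Longrightarrow> mat_trace (c \<cdot>\<^sub>m A) = c * mat_trace A"
  by (auto simp: mat_trace_def sum_distrib_left)

lemma one_plus_sX_carrier: "X \<in> carrier_mat n n \<Longrightarrow> one_plus_sX X \<in> carrier_mat n n"
  by (auto simp: one_plus_sX_def)

lemma pow_mat_Suc_left:
  assumes X: "X \<in> carrier_mat n n"
  shows "X ^\<^sub>m Suc r = X * X ^\<^sub>m r"
proof (induction r)
  case (Suc r)
  have "X ^\<^sub>m Suc (Suc r) = (X * X ^\<^sub>m r) * X" by (simp only: pow_mat.simps(2)[of X "Suc r"] Suc.IH)
  also have "\<dots> = X * X ^\<^sub>m Suc r" using assoc_mult_mat[OF X pow_carrier_mat[OF X] X] by simp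
  finally show ?case .
qed (use X in simp)

text \<open>Newton's identities between elementary symmetric functions and power sums, for a matrix over a
  field where eigenvalues need not exist. Put \<open>M = 1 + s X\<close>, \<open>D = det M = \<Sum>k. e\<^sub>k s\<^sup>k\<close>, and let \<open>Q\<close> be the
  adjugate of \<open>M\<close>, with \<open>Q\<^sub>k\<close> its coefficient of \<open>s\<^sup>k\<close>. Comparing coefficients of \<open>s\<close> in \<open>Q M = D\<close> gives
  \<open>Q\<^sub>k = e\<^sub>k - Q\<^sub>k\<^sub>-\<^sub>1 X\<close>, so \<open>Q\<^sub>k\<close> is an alternating combination of powers of \<open>X\<close>; inserting this
  into Jacobi's formula \<open>D' = Tr (Q X)\<close> gives the recursion.\<close>

lemma newton_identity:
  fixes X :: "'a::field_char_0 mat"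
  assumes X: "X \<in> carrier_mat n n"
  shows "of_nat N * minor_sum X N =
    (\<Sum>j<N. (-1) ^ j * power_trace X (Suc j) * minor_sum X (N - Suc j))"
proof (cases N)
  case (Suc m)
  let ?M = "one_plus_sX X"
  have M: "?M \<in> carrier_mat n n" using X by (rule one_plus_sX_carrier)
  define Q where "Q k = mat n n (\<lambda>(i, j). coeff (adj_mat ?M $$ (i, j)) k)" for k
  have Q: "Q k \<in> carrier_mat n n" for k by (simp add: Q_def)
  have adj: "(\<Sum>l<n. adj_mat ?M $$ (i, l) * ?M $$ (l, j)) = (if i = j then det ?M else 0)"
    if "i < n" "j < n" for i j
  proof -
    have "(adj_mat ?M * ?M) $$ (i, j) = (\<Sum>l<n. adj_mat ?M $$ (i, l) * ?M $$ (l, j))"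
      using that M adj_mat(1)[OF M] by (auto simp: scalar_prod_def atLeast0LessThan)
    then show ?thesis using that unfolding adj_mat(3)[OF M] by (cases "i = j") simp_all
  qed
  have entry: "[:if l = j then 1 else 0, X $$ (l, j):] = ?M $$ (l, j)" if "l < n" "j < n" for l j
    using that X by (simp add: one_plus_sX_def)
  have Q0: "Q 0 = minor_sum X 0 \<cdot>\<^sub>m 1\<^sub>m n"
  proof (rule eq_matI)
    fix i j assume "i < dim_row (minor_sum X 0 \<cdot>\<^sub>m 1\<^sub>m n)" "j < dim_col (minor_sum X 0 \<cdot>\<^sub>m 1\<^sub>m n)"
    then have ij: "i < n" "j < n" by auto
    have "coeff (\<Sum>l<n. adj_mat ?M $$ (i, l) * ?M $$ (l, j)) 0
        = (\<Sum>l<n. if l = j then coeff (adj_mat ?M $$ (i, l)) 0 else 0)"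
      unfolding coeff_sum
      by (intro sum.cong refl) (use ij in \<open>simp add: entry[symmetric] coeff_mult_0\<close>)
    also have "\<dots> = coeff (adj_mat ?M $$ (i, j)) 0" using ij by simp
    finally show "Q 0 $$ (i, j) = (minor_sum X 0 \<cdot>\<^sub>m 1\<^sub>m n) $$ (i, j)"
      using ij by (simp add: adj Q_def minor_sum_def split: if_splits)
  qed (simp_all add: Q_def)
  have Q_Suc: "Q (Suc k) + Q k * X = minor_sum X (Suc k) \<cdot>\<^sub>m 1\<^sub>m n" for k
  proof (rule eq_matI)
    fix i j assume "i < dim_row (minor_sum X (Suc k) \<cdot>\<^sub>m 1\<^sub>m n)"
      "j < dim_col (minor_sum X (Suc k) \<cdot>\<^sub>m 1\<^sub>m n)"
    then have ij: "i < n" "j < n" by auto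
    have "coeff (\<Sum>l<n. adj_mat ?M $$ (i, l) * ?M $$ (l, j)) (Suc k)
        = (\<Sum>l<n. (if l = j then coeff (adj_mat ?M $$ (i, l)) (Suc k) else 0)
             + coeff (adj_mat ?M $$ (i, l)) k * X $$ (l, j))"
      unfolding coeff_sum
      by (intro sum.cong refl) (use ij in \<open>auto simp: entry[symmetric] mult_pCons_right mult.commute\<close>)
    also have "\<dots> = coeff (adj_mat ?M $$ (i, j)) (Suc k)
        + (\<Sum>l<n. coeff (adj_mat ?M $$ (i, l)) k * X $$ (l, j))"
      using ij by (simp add: sum.distrib)
    also have "\<dots> = (Q (Suc k) + Q k * X) $$ (i, j)"
      using ij X by (simp add: Q_def scalar_prod_def atLeast0LessThan)
    finally show "(Q (Suc k) + Q k * X) $$ (i, j) = (minor_sum X (Suc k) \<cdot>\<^sub>m 1\<^sub>m n) $$ (i, j)"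
      using ij by (simp add: adj minor_sum_def split: if_splits)
  qed (use X Q in auto)
  \<comment> \<open>The power \<open>r\<close> is arbitrary because each use of the recursion for \<open>Q\<close> raises it by one.\<close>
  have tr: "mat_trace (Q k * X ^\<^sub>m Suc r)
      = (\<Sum>j\<le>k. (-1) ^ j * power_trace X (Suc r + j) * minor_sum X (k - j))" for k r
  proof (induction k arbitrary: r)
    case 0
    have "Q 0 * X ^\<^sub>m Suc r = minor_sum X 0 \<cdot>\<^sub>m (X ^\<^sub>m Suc r)"
      unfolding Q0 using pow_carrier_mat[OF X, of "Suc r"]
      by (metis left_mult_one_mat mult_smult_assoc_mat one_carrier_mat)
    then show ?case using pow_carrier_mat[OF X, of "Suc r"]
      by (simp add: mat_trace_smult power_trace_def del: pow_mat.simps)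
  next
    case (Suc k)
    have P: "X ^\<^sub>m r \<in> carrier_mat n n" for r using X by simp
    have comm: "X * X ^\<^sub>m Suc r = X ^\<^sub>m Suc (Suc r)" for r
      by (rule pow_mat_Suc_left[OF X, symmetric])
    have "Q (Suc k) * X ^\<^sub>m Suc r + Q k * X ^\<^sub>m Suc (Suc r)
        = (Q (Suc k) + Q k * X) * X ^\<^sub>m Suc r"
      using add_mult_distrib_mat[OF Q mult_carrier_mat[OF Q X] P, of "Suc k" k "Suc r"]
        assoc_mult_mat[OF Q X P, of k "Suc r"] by (simp del: pow_mat.simps add: comm)
    also have "\<dots> = minor_sum X (Suc k) \<cdot>\<^sub>m (X ^\<^sub>m Suc r)"
      unfolding Q_Suc by (metis left_mult_one_mat mult_smult_assoc_mat one_carrier_mat P)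
    finally have "mat_trace (Q (Suc k) * X ^\<^sub>m Suc r) + mat_trace (Q k * X ^\<^sub>m Suc (Suc r))
        = minor_sum X (Suc k) * power_trace X (Suc r)"
      by (metis mat_trace_add mat_trace_smult mult_carrier_mat P Q power_trace_def)
    then have "mat_trace (Q (Suc k) * X ^\<^sub>m Suc r) = power_trace X (Suc r) * minor_sum X (Suc k)
        + (\<Sum>j\<le>k. (-1) ^ Suc j * power_trace X (Suc r + Suc j) * minor_sum X (Suc k - Suc j))"
      unfolding Suc.IH by (simp add: algebra_simps sum_negf del: pow_mat.simps)
    then show ?case by (subst sum.atMost_Suc_shift) simp
  qed
  have "of_nat N * minor_sum X N = coeff (pderiv (det ?M)) m"
    by (simp add: minor_sum_def coeff_pderiv Suc)
  also have "\<dots> = (\<Sum>i<n. \<Sum>j<n. X $$ (i, j) * coeff (adj_mat ?M $$ (j, i)) m)"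
    unfolding pderiv_det[OF M] coeff_sum
    by (intro sum.cong refl) (use M in \<open>auto simp: entry[symmetric] pderiv_pCons adj_mat_def\<close>)
  also have "\<dots> = (\<Sum>j<n. \<Sum>i<n. coeff (adj_mat ?M $$ (j, i)) m * X $$ (i, j))"
    by (subst sum.swap) (simp add: mult.commute)
  also have "\<dots> = mat_trace (Q m * X ^\<^sub>m Suc 0)"
    using X by (simp add: mat_trace_def Q_def scalar_prod_def atLeast0LessThan)
  also have "\<dots> = (\<Sum>j<N. (-1) ^ j * power_trace X (Suc j) * minor_sum X (N - Suc j))"
    unfolding tr Suc by (simp add: lessThan_Suc_atMost del: pow_mat.simps)
  finally show ?thesis .
qed simp

lemma minor_sum_0:
  assumes X: "X \<in> carrier_mat n n"
  shows "minor_sum X 0 = 1"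
proof -
  interpret h: comm_ring_hom "\<lambda>q::'a poly. poly q 0"
    by unfold_locales auto
  have "map_mat (\<lambda>q. poly q 0) (one_plus_sX X) = 1\<^sub>m n"
    using X by (intro eq_matI) (auto simp: one_plus_sX_def)
  then show ?thesis
    unfolding minor_sum_def using h.hom_det[of "one_plus_sX X"] by (simp add: poly_0_coeff_0)
qed

lemma det_one_plus_eq_minor_sums:
  fixes X :: "'a::field mat"
  assumes X: "X \<in> carrier_mat n n"
  shows "det (1\<^sub>m n + X) = (\<Sum>N\<le>n. minor_sum X N)"
proof -
  interpret h: comm_ring_hom "\<lambda>q::'a poly. poly q 1"
    by unfold_locales auto
  let ?D = "det (one_plus_sX X)"
  have "map_mat (\<lambda>q. poly q 1) (one_plus_sX X) = 1\<^sub>m n + X"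
    using X by (intro eq_matI) (auto simp: one_plus_sX_def)
  then have "det (1\<^sub>m n + X) = poly ?D 1" using h.hom_det[of "one_plus_sX X"] by simp
  also have "degree ?D \<le> 1 * n"
    using one_plus_sX_carrier[OF X] X
    by (intro degree_det_le) (auto simp: one_plus_sX_def)
  then have "poly ?D 1 = poly (\<Sum>N\<le>n. monom (coeff ?D N) N) 1"
    by (simp add: poly_as_sum_of_monoms')
  also have "\<dots> = (\<Sum>N\<le>n. minor_sum X N)"
    by (simp add: poly_sum poly_monom minor_sum_def)
  finally show ?thesis .
qed

section \<open>The exponential formula for multisets\<close>

text \<open>In this section \<open>W\<close> is a set of objects \<open>c\<close> with lengths \<open>l c\<close> and weights \<open>w c\<close>. The number
  \<open>exp_coeff W l w N\<close> below is the coefficient of \<open>s\<^sup>N\<close> in the formal series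
  \<open>exp (\<Sum>c\<in>W. w c s\<^bsup>l c\<^esup>)\<close>, as one sees by expanding each factor \<open>exp (w c s\<^bsup>l c\<^esup>)\<close>: a multiset
  records how often each \<open>c\<close> is used, and the factorials of the multiplicities are the denominators
  of the exponential series.\<close>

definition total_length :: "('b \<Rightarrow> nat) \<Rightarrow> 'b multiset \<Rightarrow> nat" where
  "total_length l C = (\<Sum>c\<in>#C. l c)"

definition msets_of_length :: "'b set \<Rightarrow> ('b \<Rightarrow> nat) \<Rightarrow> nat \<Rightarrow> 'b multiset set" where
  "msets_of_length W l N = {C. set_mset C \<subseteq> W \<and> total_length l C = N}"

definition mset_weight :: "('b \<Rightarrow> 'a::field_char_0) \<Rightarrow> 'b multiset \<Rightarrow> 'a" where
  "mset_weight w C = (\<Prod>c\<in>#C. w c) / of_nat (mset_fact C)"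

definition exp_coeff :: "'b set \<Rightarrow> ('b \<Rightarrow> nat) \<Rightarrow> ('b \<Rightarrow> 'a::field_char_0) \<Rightarrow> nat \<Rightarrow> 'a" where
  "exp_coeff W l w N = (\<Sum>C\<in>msets_of_length W l N. mset_weight w C)"

lemma total_length_add_mset: "total_length l (add_mset c C) = l c + total_length l C"
  by (simp add: total_length_def)

lemma finite_msets_of_length:
  assumes pos: "\<And>c. c \<in> W \<Longrightarrow> l c \<ge> 1" and fin: "\<And>k. finite {c \<in> W. l c = k}"
  shows "finite (msets_of_length W l N)"
proof -
  let ?S = "\<Union>k\<le>N. {c \<in> W. l c = k}"
  have "msets_of_length W l N \<subseteq> (\<Union>m\<le>N. multisets_of_size ?S m)"
  proof
    fix C assume C: "C \<in> msets_of_length W l N"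
    have "size C = (\<Sum>c\<in>#C. 1)" by (rule size_eq_sum_mset)
    also have "\<dots> \<le> (\<Sum>c\<in>#C. l c)"
      using C pos by (intro sum_mset_mono) (auto simp: msets_of_length_def)
    finally have "size C \<le> N" using C by (simp add: msets_of_length_def total_length_def)
    moreover have "c \<in> ?S" if c: "c \<in># C" for c
    proof -
      obtain D where "C = add_mset c D" using multi_member_split[OF c] by blast
      then show ?thesis using C by (auto simp: msets_of_length_def total_length_add_mset)
    qed
    ultimately show "C \<in> (\<Union>m\<le>N. multisets_of_size ?S m)" 
      unfolding multisets_of_size_def by blast
  qed
  moreover have "finite (\<Union>m\<le>N. multisets_of_size ?S m)" using fin by blast
  ultimately show ?thesis by (rule finite_subset)
qed

lemma mset_fact_add_mset: "mset_fact (add_mset c C) = Suc (count C c) * mset_fact C"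
proof -
  have ext: "mset_fact D = (\<Prod>x\<in>insert c (set_mset C). fact (count D x))"
    if "set_mset D \<subseteq> insert c (set_mset C)" for D
    unfolding mset_fact_def using that
    by (intro prod.mono_neutral_left) (auto simp: not_in_iff)
  have "(\<Prod>x\<in>set_mset C - {c}. fact (count (add_mset c C) x) :: nat)
      = (\<Prod>x\<in>set_mset C - {c}. fact (count C x))"
    by (rule prod.cong) auto
  then have "mset_fact (add_mset c C) = fact (Suc (count C c)) * (\<Prod>x\<in>set_mset C - {c}. fact (count C x))"
    by (subst ext) (simp_all add: prod.insert_remove del: count_add_mset, simp)
  also have "\<dots> = Suc (count C c) * (fact (count C c) * (\<Prod>x\<in>set_mset C - {c}. fact (count C x)))"
    by (simp add: algebra_simps)
  also have "fact (count C c) * (\<Prod>x\<in>set_mset C - {c}. fact (count C x)) = mset_fact C"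
    by (subst ext) (auto simp add: prod.insert_remove)
  finally show ?thesis .
qed

text \<open>Marking one of the copies of \<open>c\<close> in a multiset cancels against the factorials, so that the marked
  copy can be split off with its bare weight.\<close>

lemma mset_weight_add_mset:
  "of_nat (count (add_mset c C) c) * mset_weight w (add_mset c C) = w c * mset_weight w C"
proof -
  have "(of_nat (Suc (count C c)) :: 'a) \<noteq> 0" by (rule of_nat_neq_0)
  then show ?thesis
    by (simp only: mset_weight_def mset_fact_add_mset of_nat_mult count_add_mset image_mset_add_mset
        prod_mset.add_mset if_True simp_thms mult_divide_mult_cancel_left times_divide_eq_right)
qed

lemma total_length_eq_sum_count: "total_length l C = (\<Sum>c\<in>set_mset C. count C c * l c)"
proof -
  have "total_length l D = (\<Sum>c\<in>S. count D c * l c)" if "finite S" "set_mset D \<subseteq> S" for D S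
    using that(2)
  proof (induction D)
    case (add x D)
    have "(\<Sum>c\<in>S. count (add_mset x D) c * l c)
        = (\<Sum>c\<in>S. count D c * l c + (if x = c then l c else 0))"
      by (intro sum.cong) auto
    then show ?case using add that(1) by (simp add: sum.distrib total_length_add_mset)
  qed (simp add: total_length_def)
  then show ?thesis by simp
qed

text \<open>The logarithmic derivative of an exponential series \<open>F = exp f\<close>, in the form
  \<open>s F' = (s f') F\<close>. Combinatorially: \<open>N\<close> is the sum of the lengths of the elements of a multiset, so
  multiplying by \<open>N\<close> amounts to marking an element with weight its length; the marked element is then
  removed.\<close>

lemma exp_coeff_recursion:
  fixes w :: "'b \<Rightarrow> 'a::field_char_0"
  assumes pos: "\<And>c. c \<in> W \<Longrightarrow> l c \<ge> 1" and fin: "\<And>k. finite {c \<in> W. l c = k}"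
  shows "of_nat N * exp_coeff W l w N =
    (\<Sum>j<N. (\<Sum>c\<in>{c \<in> W. l c = Suc j}. of_nat (l c) * w c) * exp_coeff W l w (N - Suc j))"
proof -
  let ?M = "msets_of_length W l"
  let ?f = "\<lambda>(C, c). of_nat (l c) * (of_nat (count C c) * mset_weight w C)"
  have finM: "finite (?M N)" for N by (rule finite_msets_of_length[OF pos fin])
  have "of_nat N * exp_coeff W l w N
      = (\<Sum>C\<in>?M N. \<Sum>c\<in>set_mset C. of_nat (l c) * (of_nat (count C c) * mset_weight w C))"
    unfolding exp_coeff_def sum_distrib_left
  proof (rule sum.cong[OF refl])
    fix C assume "C \<in> ?M N"
    then have "N = (\<Sum>c\<in>set_mset C. count C c * l c)"
      by (simp add: msets_of_length_def total_length_eq_sum_count)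
    then have "(of_nat N :: 'a) = (\<Sum>c\<in>set_mset C. of_nat (count C c) * of_nat (l c))" by simp
    then show "of_nat N * mset_weight w C
        = (\<Sum>c\<in>set_mset C. of_nat (l c) * (of_nat (count C c) * mset_weight w C))"
      by (simp only: sum_distrib_right mult.assoc) (intro sum.cong refl mult.left_commute)
  qed
  also have "\<dots> = sum ?f (SIGMA C:?M N. set_mset C)"
    using finM by (subst sum.Sigma) auto
  also have "\<dots> = (\<Sum>(j, c, D)\<in>(SIGMA j:{..<N}. {c \<in> W. l c = Suc j} \<times> ?M (N - Suc j)).
      of_nat (l c) * w c * mset_weight w D)"
  proof (rule sum.reindex_bij_witness[where
        i = "\<lambda>(j, c, D). (add_mset c D, c)" and j = "\<lambda>(C, c). (l c - 1, c, C - {#c#})"])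
    fix x assume "x \<in> (SIGMA C:?M N. set_mset C)"
    then obtain C c where x: "x = (C, c)" "C \<in> ?M N" "c \<in># C" by auto
    then obtain D where D: "C = add_mset c D" using multi_member_split[OF x(3)] by blast
    have "l c \<ge> 1" using x pos by (auto simp: msets_of_length_def)
    moreover have "set_mset D \<subseteq> W" "l c + total_length l D = N" "c \<in> W"
      using x D by (auto simp: msets_of_length_def total_length_add_mset)
    ultimately have "(l c - 1, c, D) \<in> (SIGMA j:{..<N}. {c \<in> W. l c = Suc j} \<times> ?M (N - Suc j))"
      by (auto simp: msets_of_length_def)
    then show "(case case x of (C, c) \<Rightarrow> (l c - 1, c, C - {#c#}) of (j, c, D) \<Rightarrow> (add_mset c D, c)) = x"
      "(case x of (C, c) \<Rightarrow> (l c - 1, c, C - {#c#}))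
        \<in> (SIGMA j:{..<N}. {c \<in> W. l c = Suc j} \<times> ?M (N - Suc j))"
      "(case (case x of (C, c) \<Rightarrow> (l c - 1, c, C - {#c#})) of
          (j, c, D) \<Rightarrow> of_nat (l c) * w c * mset_weight w D) = ?f x"
      by (simp_all only: x(1) D prod.case add_mset_remove_trivial mset_weight_add_mset mult.assoc)
  next
    fix y assume "y \<in> (SIGMA j:{..<N}. {c \<in> W. l c = Suc j} \<times> ?M (N - Suc j))"
    then show "(case case y of (j, c, D) \<Rightarrow> (add_mset c D, c) of (C, c) \<Rightarrow> (l c - 1, c, C - {#c#})) = y"
      "(case y of (j, c, D) \<Rightarrow> (add_mset c D, c)) \<in> (SIGMA C:?M N. set_mset C)"
      by (auto simp: msets_of_length_def total_length_add_mset)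
  qed
  also have "\<dots> = (\<Sum>j<N. \<Sum>(c, D)\<in>{c \<in> W. l c = Suc j} \<times> ?M (N - Suc j).
      of_nat (l c) * w c * mset_weight w D)"
    using finM fin by (subst sum.Sigma) (auto simp: split_def)
  also have "\<dots> = (\<Sum>j<N. (\<Sum>c\<in>{c \<in> W. l c = Suc j}. of_nat (l c) * w c) * exp_coeff W l w (N - Suc j))"
    unfolding exp_coeff_def sum_product sum.cartesian_product ..
  finally show ?thesis .
qed

lemma exp_coeff_0:
  assumes pos: "\<And>c. c \<in> W \<Longrightarrow> l c \<ge> 1"
  shows "exp_coeff W l w 0 = 1"
proof -
  have "msets_of_length W l 0 = {{#}}"
  proof -
    have "C = {#}" if C: "C \<in> msets_of_length W l 0" for C
    proof (rule ccontr)
      assume "C \<noteq> {#}"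
      then obtain c D where "C = add_mset c D" by (metis multiset_cases)
      then show False using C pos[of c] by (auto simp: msets_of_length_def total_length_add_mset)
    qed
    then show ?thesis by (auto simp: msets_of_length_def total_length_def)
  qed
  then show ?thesis by (simp add: exp_coeff_def mset_weight_def mset_fact_def)
qed

section \<open>Orbits of cyclic shifts\<close>

text \<open>Orbit and stabiliser: every fibre of \<open>m \<mapsto> rotate m as\<close> is a translate, modulo the length, of
  the stabiliser.\<close>

lemma card_cyc_orbit:
  assumes "as \<noteq> []"
  shows "card (cyc_orbit as) * list_val as = length as"
proof -
  let ?k = "length as"
  let ?fib = "\<lambda>bs. {m \<in> {..<?k}. rotate m as = bs}"
  have k: "?k > 0" using assms by simp
  have fibre: "card (?fib bs) = list_val as" if bs: "bs \<in> cyc_orbit as" for bs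
  proof -
    obtain j where j: "j < ?k" "bs = rotate j as" using bs by (auto simp: cyc_orbit_def)
    have inj: "rotate j xs = rotate j ys \<longleftrightarrow> xs = ys" for xs ys :: "'a list"
    proof
      assume eq: "rotate j xs = rotate j ys"
      have "inj (rotate j :: 'a list \<Rightarrow> _)" 
        unfolding rotate_def by (intro inj_fn inj_rotate1)
      then show "xs = ys" using eq by (simp add: inj_eq)
    qed simp
    \<comment> \<open>Translation by \<open>j\<close> moves the stabiliser onto the fibre over \<open>rotate j as\<close>.\<close>
    have "bij_betw (\<lambda>m. (j + m) mod ?k) {m. m < ?k \<and> rotate m as = as} (?fib bs)"
    proof (rule bij_betw_byWitness[where f' = "\<lambda>m. (m + ?k - j) mod ?k"])
      have mod: "m mod ?k = (if m < ?k then m else m - ?k)" if "m < 2 * ?k" for m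
        using that by (simp add: le_mod_geq)
      have "((j + m) mod ?k + ?k - j) mod ?k = m" if "m < ?k" for m
        using that j by (cases "j + m < ?k") (simp_all add: mod)
      then show "\<forall>m\<in>{m. m < ?k \<and> rotate m as = as}. ((j + m) mod ?k + ?k - j) mod ?k = m" by blast
      have unshift: "(j + (m + ?k - j) mod ?k) mod ?k = m" if "m < ?k" for m
        using that j by (cases "j \<le> m") (simp_all add: mod, arith)
      then show "\<forall>m\<in>?fib bs. (j + (m + ?k - j) mod ?k) mod ?k = m" by blast
      have shift: "rotate ((j + m) mod ?k) as = rotate j (rotate m as)" for m
        by (metis rotate_conv_mod rotate_rotate)
      show "(\<lambda>m. (j + m) mod ?k) ` {m. m < ?k \<and> rotate m as = as} \<subseteq> ?fib bs"
        using k shift j by auto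
      show "(\<lambda>m. (m + ?k - j) mod ?k) ` ?fib bs \<subseteq> {m. m < ?k \<and> rotate m as = as}"
      proof clarify
        fix m assume m: "m < ?k" "bs = rotate m as"
        have "rotate j (rotate ((m + ?k - j) mod ?k) as) = rotate j as"
          using shift[of "(m + ?k - j) mod ?k"] unshift[OF m(1)] m j by simp
        then show "(m + ?k - j) mod ?k < ?k \<and> rotate ((m + ?k - j) mod ?k) as = as"
          using k by (simp add: inj)
      qed
    qed
    then show ?thesis by (simp add: bij_betw_same_card list_val_def)
  qed
  have orb: "cyc_orbit as = (\<lambda>m. rotate m as) ` {..<?k}" by (auto simp: cyc_orbit_def)
  have "?k = (\<Sum>bs\<in>cyc_orbit as. card (?fib bs))"
    using sum_fun_comp[of "{..<?k}" "cyc_orbit as" "\<lambda>m. rotate m as" "\<lambda>_. 1 :: nat"]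
    by (simp add: orb)
  then show ?thesis using fibre by simp
qed

lemma cyc_orbit_eq_of_mem:
  assumes "bs \<in> cyc_orbit as"
  shows "cyc_orbit bs = cyc_orbit as"
proof -
  obtain j where j: "j < length as" "bs = rotate j as" using assms by (auto simp: cyc_orbit_def)
  have all: "cyc_orbit as = range (\<lambda>m. rotate m as)" if "as \<noteq> []" for as :: "'a list"
    using that by (auto simp: cyc_orbit_def) (metis length_greater_0_conv mod_less_divisor rotate_conv_mod)
  have ne: "as \<noteq> []" "bs \<noteq> []" using j by auto
  have "range (\<lambda>m. rotate m bs) = range (\<lambda>m. rotate m as)"
  proof
    show "range (\<lambda>m. rotate m bs) \<subseteq> range (\<lambda>m. rotate m as)" using j by (auto simp: rotate_rotate)
    have "rotate m as = rotate (m + (length as - j)) bs" for m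
      using j by (simp add: rotate_rotate add.assoc) (metis rotate_conv_mod mod_add_self2)
    then show "range (\<lambda>m. rotate m as) \<subseteq> range (\<lambda>m. rotate m bs)" by auto
  qed
  then show ?thesis using ne by (simp add: all)
qed

lemma cyc_orbit_self: "as \<noteq> [] \<Longrightarrow> as \<in> cyc_orbit as"
  unfolding cyc_orbit_def by (auto intro: exI[of _ 0])

lemma closed_walks_nonempty: "as \<in> closed_walks p \<Longrightarrow> as \<noteq> []"
  unfolding closed_walks_def by force

lemma rotate1_closed_walk:
  assumes "as \<in> closed_walks p"
  shows "rotate1 as \<in> closed_walks p"
proof -
  let ?k = "length as"
  have k: "?k \<ge> 2" and d: "\<And>i. i < ?k \<Longrightarrow> as ! i \<noteq> as ! (Suc i mod ?k)" and "set as \<subseteq> {1..p}"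
    using assms by (auto simp: closed_walks_def)
  have "rotate1 as ! i \<noteq> rotate1 as ! (Suc i mod ?k)" if i: "i < ?k" for i
  proof -
    have "Suc i mod ?k < ?k" using i by (intro mod_less_divisor) linarith
    then show ?thesis using i d[of "Suc i mod ?k"] by (simp add: nth_rotate1)
  qed
  then show ?thesis using assms by (simp add: closed_walks_def)
qed

lemma rotate_closed_walk: "as \<in> closed_walks p \<Longrightarrow> rotate m as \<in> closed_walks p"
  by (induction m) (simp_all add: rotate1_closed_walk)

lemma finite_closed_walks_of_length: "finite {as \<in> closed_walks p. length as = k}"
  by (rule finite_subset[OF _ finite_lists_length_eq[of "{1..p}" k]]) (auto simp: closed_walks_def)

lemma cyclic_walks_of_length:
  "{c \<in> cyclic_walks p. cyc_length c = k} = cyc_orbit ` {as \<in> closed_walks p. length as = k}"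
  by (auto simp: cyclic_walks_def cyc_length_orbit closed_walks_nonempty)

lemma finite_cyclic_walks_of_length: "finite {c \<in> cyclic_walks p. cyc_length c = k}"
  unfolding cyclic_walks_of_length by (intro finite_imageI finite_closed_walks_of_length)

lemma cyc_length_pos: "c \<in> cyclic_walks p \<Longrightarrow> cyc_length c \<ge> 1"
  by (auto simp: cyclic_walks_def cyc_length_orbit closed_walks_nonempty Suc_le_eq)

text \<open>A cyclic walk \<open>c\<close> consists of \<open>cyc_length c / cyc_val c\<close> closed walks with a starting point. This is
  how the valuations in the determinant formula arise: the factor \<open>cyc_length c\<close> comes from the
  recursion for the exponential.\<close>

lemma sum_cyclic_walks_eq_sum_closed_walks:
  fixes f :: "nat list set \<Rightarrow> 'a::field_char_0"
  shows "(\<Sum>c\<in>{c \<in> cyclic_walks p. cyc_length c = k}. of_nat (cyc_length c) * (f c / of_nat (cyc_val c)))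
    = (\<Sum>as\<in>{as \<in> closed_walks p. length as = k}. f (cyc_orbit as))"
proof -
  let ?S = "{as \<in> closed_walks p. length as = k}"
  have "(\<Sum>as\<in>?S. f (cyc_orbit as)) = (\<Sum>c\<in>cyc_orbit ` ?S. \<Sum>as\<in>{as \<in> ?S. cyc_orbit as = c}. f (cyc_orbit as))"
    by (rule sum.group[symmetric]) (simp_all add: finite_closed_walks_of_length)
  also have "\<dots> = (\<Sum>c\<in>cyc_orbit ` ?S. of_nat (cyc_length c) * (f c / of_nat (cyc_val c)))"
  proof (rule sum.cong[OF refl])
    fix c assume "c \<in> cyc_orbit ` ?S"
    then obtain as where as: "as \<in> closed_walks p" "length as = k" "c = cyc_orbit as" by auto
    have ne: "as \<noteq> []" using as(1) by (rule closed_walks_nonempty)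
    have "{bs \<in> ?S. cyc_orbit bs = c} = c"
    proof
      show "{bs \<in> ?S. cyc_orbit bs = c} \<subseteq> c"
        using cyc_orbit_self closed_walks_nonempty by blast
      show "c \<subseteq> {bs \<in> ?S. cyc_orbit bs = c}"
        using as by (auto dest: cyc_orbit_eq_of_mem) (auto simp: cyc_orbit_def rotate_closed_walk)
    qed
    then have fib: "(\<Sum>bs\<in>{bs \<in> ?S. cyc_orbit bs = c}. f (cyc_orbit bs)) = of_nat (card c) * f c"
      by (metis (mono_tags, lifting) mem_Collect_eq sum.cong sum_constant)
    have "of_nat (card c) * of_nat (cyc_val c) = (of_nat (cyc_length c) :: 'a)"
      using card_cyc_orbit[OF ne] ne by (simp add: as cyc_val_orbit cyc_length_orbit flip: of_nat_mult)
    moreover have "cyc_val c \<noteq> 0" 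
      using card_cyc_orbit[OF ne] ne by (metis as(3) cyc_val_orbit length_0_conv mult_0_right)
    ultimately have "of_nat (card c) * f c = of_nat (cyc_length c) * (f c / of_nat (cyc_val c))"
      by (simp add: field_simps)
    then show "(\<Sum>bs\<in>{bs \<in> ?S. cyc_orbit bs = c}. f (cyc_orbit bs))
        = of_nat (cyc_length c) * (f c / of_nat (cyc_val c))"
      using fib by (rule trans[rotated])
  qed
  finally show ?thesis by (simp add: cyclic_walks_of_length)
qed

section \<open>Traces of powers as sums over closed walks\<close>

lemma block_offset_Suc_eq_sum: "block_offset ns (Suc p) = (\<Sum>a = 1..p. ns a)"
  by (simp add: block_offset_def atLeastLessThanSuc_atLeastAtMost)

lemma block_offset_mono: "a \<le> b \<Longrightarrow> block_offset ns a \<le> block_offset ns b"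
  unfolding block_offset_def by (intro sum_mono2) auto

lemma block_offset_Suc: "a \<ge> 1 \<Longrightarrow> block_offset ns (Suc a) = block_offset ns a + ns a"
  by (simp add: block_offset_def)

lemma block_entry_bound:
  assumes "a \<in> {1..p}" "i < ns a"
  shows "block_offset ns a + i < (\<Sum>a = 1..p. ns a)"
proof -
  have "block_offset ns a + i < block_offset ns (Suc a)" using assms by (simp add: block_offset_Suc)
  also have "\<dots> \<le> block_offset ns (Suc p)" using assms by (intro block_offset_mono) simp
  finally show ?thesis by (simp only: block_offset_Suc_eq_sum)
qed

lemma sum_lessThan_add:
  fixes g :: "nat \<Rightarrow> 'a::comm_monoid_add"
  shows "(\<Sum>l<m + k. g l) = (\<Sum>l<m. g l) + (\<Sum>i<k. g (m + i))"
  by (induction k) (simp_all add: add.assoc)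

lemma sum_blocks:
  fixes g :: "nat \<Rightarrow> 'a::comm_monoid_add"
  shows "(\<Sum>l<(\<Sum>a = 1..p. ns a). g l) = (\<Sum>a = 1..p. \<Sum>i<ns a. g (block_offset ns a + i))"
proof (induction p)
  case (Suc p)
  have "(\<Sum>l<(\<Sum>a = 1..Suc p. ns a). g l) = (\<Sum>l<(\<Sum>a = 1..p. ns a) + ns (Suc p). g l)" by simp
  also have "\<dots> = (\<Sum>a = 1..p. \<Sum>i<ns a. g (block_offset ns a + i))
      + (\<Sum>i<ns (Suc p). g ((\<Sum>a = 1..p. ns a) + i))"
    by (simp only: sum_lessThan_add Suc.IH)
  finally show ?case by (simp add: block_offset_Suc_eq_sum)
qed simp

text \<open>The block that contains the matrix index \<open>i\<close>: the first one whose end lies beyond \<open>i\<close>. Past the last block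
  the value depends on \<open>ns\<close> outside the range of blocks and has no meaning.\<close>

definition block_index :: "(nat \<Rightarrow> nat) \<Rightarrow> nat \<Rightarrow> nat" where
  "block_index ns i = (LEAST a. i < block_offset ns (Suc a))"

lemma block_index_eq:
  assumes "a \<ge> 1" "i < ns a"
  shows "block_index ns (block_offset ns a + i) = a"
  unfolding block_index_def
proof (rule Least_equality)
  show "block_offset ns a + i < block_offset ns (Suc a)" using assms by (simp add: block_offset_Suc)
  fix b assume b: "block_offset ns a + i < block_offset ns (Suc b)"
  show "a \<le> b"
  proof (rule ccontr)
    assume "\<not> a \<le> b"
    then show False using b block_offset_mono[of "Suc b" a ns] by simp
  qed
qed

lemma block_index_cases:
  assumes "l < (\<Sum>a = 1..p. ns a)"
  obtains a i where "a \<in> {1..p}" "i < ns a" "l = block_offset ns a + i"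
proof -
  have "l < block_offset ns (Suc p)" using assms by (simp only: block_offset_Suc_eq_sum)
  then have "\<exists>a\<in>{1..p}. \<exists>i<ns a. l = block_offset ns a + i"
  proof (induction p)
    case (Suc p)
    show ?case
    proof (cases "l < block_offset ns (Suc p)")
      case True
      then show ?thesis using Suc.IH by (metis atLeastAtMost_iff le_SucI)
    next
      case False
      then show ?thesis using Suc.prems
        by (intro bexI[of _ "Suc p"] exI[of _ "l - block_offset ns (Suc p)"])
          (auto simp: block_offset_Suc)
    qed
  qed (simp add: block_offset_def)
  then show ?thesis using that by blast
qed

lemma sum_lists_Suc:
  assumes "finite S"
  shows "(\<Sum>as\<in>{as. set as \<subseteq> S \<and> length as = Suc k}. g as)
    = (\<Sum>a\<in>S. \<Sum>as\<in>{as. set as \<subseteq> S \<and> length as = k}. g (a # as))"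
proof -
  have "(\<Sum>as\<in>{as. set as \<subseteq> S \<and> length as = Suc k}. g as)
      = (\<Sum>(a, as)\<in>S \<times> {as. set as \<subseteq> S \<and> length as = k}. g (a # as))"
    by (rule sum.reindex_bij_witness[where i = "\<lambda>(a, as). a # as" and j = "\<lambda>as. (hd as, tl as)"])
      (auto simp: length_Suc_conv)
  then show ?thesis by (simp add: sum.cartesian_product)
qed

text \<open>Multiplying out a power of \<open>X\<close> block by block. Consecutive vertices may still coincide here.\<close>

lemma power_entry_eq_sum_paths:
  fixes X :: "'a::comm_ring_1 mat"
  assumes X: "X \<in> carrier_mat n n" and n: "n = (\<Sum>a = 1..p. ns a)"
    and "a \<in> {1..p}" "b \<in> {1..p}" "i < ns a" "j < ns b"
  shows "(X ^\<^sub>m Suc k) $$ (block_offset ns a + i, block_offset ns b + j)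
    = (\<Sum>as\<in>{as. set as \<subseteq> {1..p} \<and> length as = k}. path_prod ns X (a # as @ [b]) $$ (i, j))"
  using assms(3-)
proof (induction k arbitrary: a i)
  case 0
  have "path_prod ns X [a, b] = block ns X a b"
    by (simp add: right_mult_one_mat[OF block_carrier])
  moreover have "{as :: nat list. set as \<subseteq> {1..p} \<and> length as = 0} = {[]}" by auto
  ultimately show ?case using 0 X by (simp add: block_def)
next
  case (Suc k)
  let ?L = "{as. set as \<subseteq> {1..p} \<and> length as = k}"
  have P: "X ^\<^sub>m r \<in> carrier_mat n n" for r using X by simp
  have bd: "block_offset ns c + l < n" if "c \<in> {1..p}" "l < ns c" for c l
    unfolding n using that by (rule block_entry_bound)
  have "X ^\<^sub>m Suc (Suc k) = X * X ^\<^sub>m Suc k"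
    by (rule pow_mat_Suc_left[OF X])
  then have "(X ^\<^sub>m Suc (Suc k)) $$ (block_offset ns a + i, block_offset ns b + j)
      = (\<Sum>l<n. X $$ (block_offset ns a + i, l) * (X ^\<^sub>m Suc k) $$ (l, block_offset ns b + j))"
    using X P[of "Suc k"] bd Suc.prems
    by (simp add: scalar_prod_def atLeast0LessThan del: pow_mat.simps)
  also have "\<dots> = (\<Sum>c\<in>{1..p}. \<Sum>l<ns c. X $$ (block_offset ns a + i, block_offset ns c + l)
      * (X ^\<^sub>m Suc k) $$ (block_offset ns c + l, block_offset ns b + j))"
    unfolding n by (rule sum_blocks)
  also have "\<dots> = (\<Sum>c\<in>{1..p}. \<Sum>l<ns c. \<Sum>as\<in>?L. block ns X a c $$ (i, l)
      * path_prod ns X (c # as @ [b]) $$ (l, j))"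
    using Suc.prems by (intro sum.cong refl) (simp add: Suc.IH sum_distrib_left block_def del: pow_mat.simps)
  also have "\<dots> = (\<Sum>c\<in>{1..p}. \<Sum>as\<in>?L. path_prod ns X (a # (c # as) @ [b]) $$ (i, j))"
  proof (rule sum.cong[OF refl])
    fix c assume "c \<in> {1..p}"
    have "(\<Sum>l<ns c. block ns X a c $$ (i, l) * path_prod ns X (c # as @ [b]) $$ (l, j))
        = path_prod ns X (a # (c # as) @ [b]) $$ (i, j)" for as
      using Suc.prems path_prod_carrier[of "c # as @ [b]" ns X] block_carrier[of ns X a c]
      by (auto simp: scalar_prod_def atLeast0LessThan simp del: block_carrier)
    then show "(\<Sum>l<ns c. \<Sum>as\<in>?L. block ns X a c $$ (i, l) * path_prod ns X (c # as @ [b]) $$ (l, j))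
        = (\<Sum>as\<in>?L. path_prod ns X (a # (c # as) @ [b]) $$ (i, j))"
      by (subst sum.swap) simp
  qed
  also have "\<dots> = (\<Sum>as\<in>{as. set as \<subseteq> {1..p} \<and> length as = Suc k}. path_prod ns X (a # as @ [b]) $$ (i, j))"
    by (simp only: sum_lists_Suc[OF finite_atLeastAtMost])
  finally show ?case .
qed

lemma power_trace_eq_sum_list_traces:
  fixes X :: "'a::comm_ring_1 mat"
  assumes X: "X \<in> carrier_mat n n" and n: "n = (\<Sum>a = 1..p. ns a)"
  shows "power_trace X (Suc k)
    = (\<Sum>as\<in>{as. set as \<subseteq> {1..p} \<and> length as = Suc k}. list_trace ns X as)"
proof -
  let ?L = "{as. set as \<subseteq> {1..p} \<and> length as = k}"
  have P: "X ^\<^sub>m Suc k \<in> carrier_mat n n" using X by (rule pow_carrier_mat)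
  have "power_trace X (Suc k) = (\<Sum>l<n. (X ^\<^sub>m Suc k) $$ (l, l))"
    using X by (simp add: power_trace_def mat_trace_def del: pow_mat.simps)
  also have "\<dots> = (\<Sum>a\<in>{1..p}. \<Sum>i<ns a. (X ^\<^sub>m Suc k) $$ (block_offset ns a + i, block_offset ns a + i))"
    unfolding n by (rule sum_blocks)
  also have "\<dots> = (\<Sum>a\<in>{1..p}. \<Sum>i<ns a. \<Sum>as\<in>?L. path_prod ns X (a # as @ [a]) $$ (i, i))"
    by (intro sum.cong refl power_entry_eq_sum_paths[OF X n]) auto
  also have "\<dots> = (\<Sum>a\<in>{1..p}. \<Sum>as\<in>?L. list_trace ns X (a # as))"
  proof (rule sum.cong[OF refl])
    fix a
    have "list_trace ns X (a # as) = (\<Sum>i<ns a. path_prod ns X (a # as @ [a]) $$ (i, i))" for as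
      using path_prod_carrier[of "a # as @ [a]" ns X] by (simp add: list_trace_def mat_trace_def)
    then show "(\<Sum>i<ns a. \<Sum>as\<in>?L. path_prod ns X (a # as @ [a]) $$ (i, i)) = (\<Sum>as\<in>?L. list_trace ns X (a # as))"
      by (subst sum.swap) simp
  qed
  also have "\<dots> = (\<Sum>as\<in>{as. set as \<subseteq> {1..p} \<and> length as = Suc k}. list_trace ns X as)"
    by (simp only: sum_lists_Suc[OF finite_atLeastAtMost])
  finally show ?thesis .
qed

text \<open>The matrix \<open>T B\<close>, where \<open>B\<close> is \<open>A\<close> without its diagonal blocks and \<open>T\<close> is the diagonal matrix with
  value \<open>t a\<close> on block \<open>a\<close>.\<close>

definition scaled_offdiag :: "(nat \<Rightarrow> nat) \<Rightarrow> 'a::comm_ring_1 mat \<Rightarrow> (nat \<Rightarrow> 'a) \<Rightarrow> 'a mat" where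
  "scaled_offdiag ns A t = mat (dim_row A) (dim_col A)
     (\<lambda>(i, j). if block_index ns i = block_index ns j then 0 else t (block_index ns i) * A $$ (i, j))"

lemma scaled_offdiag_carrier: "A \<in> carrier_mat n n \<Longrightarrow> scaled_offdiag ns A t \<in> carrier_mat n n"
  by (auto simp: scaled_offdiag_def)

lemma block_scaled_offdiag:
  assumes A: "A \<in> carrier_mat n n" and n: "n = (\<Sum>a = 1..p. ns a)" and ab: "a \<in> {1..p}" "b \<in> {1..p}"
  shows "block ns (scaled_offdiag ns A t) a b
    = (if a = b then 0\<^sub>m (ns a) (ns b) else t a \<cdot>\<^sub>m block ns A a b)"
proof -
  have bd: "block_offset ns c + l < n" if "c \<in> {1..p}" "l < ns c" for c l
    unfolding n using that by (rule block_entry_bound)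
  show ?thesis
    using A ab bd by (intro eq_matI) (auto simp: block_def scaled_offdiag_def block_index_eq)
qed

text \<open>The diagonal blocks vanish, so a path with a step inside one block contributes nothing. Each step is
  scaled by the variable of the block it leaves; hence the last vertex does not count.\<close>

lemma path_prod_scaled_offdiag:
  assumes A: "A \<in> carrier_mat n n" and n: "n = (\<Sum>a = 1..p. ns a)"
    and "as \<noteq> []" "set as \<subseteq> {1..p}"
  shows "path_prod ns (scaled_offdiag ns A t) as =
    (if successively (\<noteq>) as then prod_list (map t (butlast as)) \<cdot>\<^sub>m path_prod ns A as
     else 0\<^sub>m (ns (hd as)) (ns (last as)))"
  using assms(3-)
proof (induction as rule: induct_list012)
  case (3 a b as)
  let ?P = "path_prod ns A (b # as)"
  have P: "?P \<in> carrier_mat (ns b) (ns (last (b # as)))"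
    using path_prod_carrier[of "b # as" ns A] by simp
  have ab: "a \<in> {1..p}" "b \<in> {1..p}" using "3.prems" by auto
  have B: "block ns A a b \<in> carrier_mat (ns a) (ns b)" by simp
  have IH: "path_prod ns (scaled_offdiag ns A t) (b # as) =
    (if successively (\<noteq>) (b # as) then prod_list (map t (butlast (b # as))) \<cdot>\<^sub>m ?P
     else 0\<^sub>m (ns b) (ns (last (b # as))))" 
    using "3.IH"(2) "3.prems" by simp
  have "(r \<cdot>\<^sub>m block ns A a b) * (s \<cdot>\<^sub>m ?P) = (r * s) \<cdot>\<^sub>m (block ns A a b * ?P)" for r s
    using mult_smult_assoc_mat[OF B smult_carrier_mat[OF P], of r s] mult_smult_distrib[OF B P, of s]
    by (intro eq_matI) (simp_all add: mult.assoc)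
  moreover have "0\<^sub>m (ns a) (ns b) * (s \<cdot>\<^sub>m ?P) = 0\<^sub>m (ns a) (ns (last (b # as)))" for s
    using P by (intro left_mult_zero_mat) simp
  moreover have "(r \<cdot>\<^sub>m block ns A a b) * 0\<^sub>m (ns b) (ns (last (b # as)))
      = 0\<^sub>m (ns a) (ns (last (b # as)))" for r
    using B by (intro right_mult_zero_mat) simp
  moreover have "0\<^sub>m (ns a) (ns b) * 0\<^sub>m (ns b) (ns (last (b # as)))
      = (0\<^sub>m (ns a) (ns (last (b # as))) :: 'a mat)"
    by simp
  ultimately show ?case
    unfolding path_prod.simps(3) IH block_scaled_offdiag[OF A n ab] by auto
qed auto

text \<open>The condition also excludes lists of length one: their closing step would go from a vertex to
  itself.\<close>

lemma closed_walk_iff_successively: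
  assumes "set as \<subseteq> {1..p}" "as \<noteq> []"
  shows "as \<in> closed_walks p \<longleftrightarrow> successively (\<noteq>) (as @ [hd as])"
proof -
  let ?k = "length as"
  have nth: "(as @ [hd as]) ! Suc i = as ! (Suc i mod ?k)" if "i < ?k" for i
    using that assms(2) by (cases "Suc i = ?k") (auto simp: nth_append hd_conv_nth)
  have "successively (\<noteq>) (as @ [hd as]) \<longleftrightarrow> (\<forall>i<?k. as ! i \<noteq> as ! (Suc i mod ?k))"
    unfolding successively_conv_nth using nth by (auto simp: nth_append)
  moreover have "?k \<ge> 2" if "\<forall>i<?k. as ! i \<noteq> as ! (Suc i mod ?k)"
  proof (rule ccontr)
    assume "\<not> ?k \<ge> 2"
    then have "?k = 1" using assms(2) by (cases as) (auto simp: not_le)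
    then show False using that[rule_format, of 0] by simp
  qed
  ultimately show ?thesis using assms(1) by (auto simp: closed_walks_def)
qed

lemma prod_list_map_eq_prod_count:
  fixes t :: "'b \<Rightarrow> 'a::comm_monoid_mult"
  assumes "set as \<subseteq> S" "finite S"
  shows "prod_list (map t as) = (\<Prod>a\<in>S. t a ^ count_list as a)"
  using assms(1)
proof (induction as)
  case (Cons x as)
  have "(\<Prod>a\<in>S. t a ^ count_list (x # as) a) = (\<Prod>a\<in>S. (if x = a then t a else 1) * t a ^ count_list as a)"
    by (intro prod.cong) auto
  then show ?case using Cons assms(2) by (simp add: prod.distrib)
qed simp

text \<open>Since the closing step of a closed walk returns to its first vertex, every visit at \<open>a\<close> is left
  exactly once and contributes one factor \<open>t a\<close>.\<close>

lemma power_trace_scaled_offdiag: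
  assumes A: "A \<in> carrier_mat n n" and n: "n = (\<Sum>a = 1..p. ns a)"
  shows "power_trace (scaled_offdiag ns A t) (Suc k) =
    (\<Sum>as\<in>{as \<in> closed_walks p. length as = Suc k}.
       (\<Prod>a = 1..p. t a ^ count_list as a) * list_trace ns A as)"
proof -
  let ?X = "scaled_offdiag ns A t"
  let ?L = "{as. set as \<subseteq> {1..p} \<and> length as = Suc k}"
  have "list_trace ns ?X as = (if as \<in> closed_walks p
      then (\<Prod>a = 1..p. t a ^ count_list as a) * list_trace ns A as else 0)" if as: "as \<in> ?L" for as
  proof -
    have ne: "as \<noteq> []" "set as \<subseteq> {1..p}" using as by auto
    have sub: "set (as @ [hd as]) \<subseteq> {1..p}" using ne(2) subsetD[OF ne(2) hd_in_set[OF ne(1)]] by simp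
    have c: "path_prod ns A (as @ [hd as]) \<in> carrier_mat (ns (hd as)) (ns (hd as))"
      using path_prod_carrier[of "as @ [hd as]" ns A] ne by simp
    show ?thesis
      using path_prod_scaled_offdiag[OF A n _ sub, of t] ne
      by (auto simp: list_trace_def closed_walk_iff_successively mat_trace_smult[OF c]
          prod_list_map_eq_prod_count[OF ne(2) finite_atLeastAtMost] mat_trace_def[of "0\<^sub>m _ _"])
  qed
  then have "power_trace ?X (Suc k) = (\<Sum>as\<in>?L. if as \<in> closed_walks p
      then (\<Prod>a = 1..p. t a ^ count_list as a) * list_trace ns A as else 0)"
    unfolding power_trace_eq_sum_list_traces[OF scaled_offdiag_carrier[OF A] n]
    by (intro sum.cong) auto
  also have "\<dots> = (\<Sum>as\<in>?L \<inter> closed_walks p. (\<Prod>a = 1..p. t a ^ count_list as a) * list_trace ns A as)"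
    by (subst sum.inter_restrict) (simp_all add: finite_lists_length_eq)
  also have "?L \<inter> closed_walks p = {as \<in> closed_walks p. length as = Suc k}"
    by (auto simp: closed_walks_def)
  finally show ?thesis .
qed

section \<open>Separating the block variables\<close>

lemma sum_less_base_power:
  fixes u :: "nat \<Rightarrow> nat"
  assumes "\<And>a. a \<in> {1..p} \<Longrightarrow> u a < M" "M \<ge> 1"
  shows "(\<Sum>a = 1..p. u a * M ^ a) < M ^ Suc p"
  using assms(1)
proof (induction p)
  case (Suc p)
  have "(\<Sum>a = 1..p. u a * M ^ a) < M ^ Suc p" using Suc by simp
  moreover have "u (Suc p) * M ^ Suc p \<le> (M - 1) * M ^ Suc p"
    using Suc.prems[of "Suc p"] by (intro mult_right_mono) auto
  moreover have "(M - 1) * M ^ Suc p + M ^ Suc p = M ^ Suc (Suc p)"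
    using assms(2) by (cases M) auto
  moreover have "(\<Sum>a = 1..Suc p. u a * M ^ a) = (\<Sum>a = 1..p. u a * M ^ a) + u (Suc p) * M ^ Suc p"
    by simp
  ultimately show ?case by linarith
qed (use assms(2) in simp)

text \<open>Kronecker's substitution: exponent vectors with entries below \<open>M\<close> can be read as numbers in
  base \<open>M\<close>.\<close>

lemma base_digits_unique:
  fixes u v :: "nat \<Rightarrow> nat"
  assumes "\<And>a. a \<in> {1..p} \<Longrightarrow> u a < M" "\<And>a. a \<in> {1..p} \<Longrightarrow> v a < M" "M \<ge> 1"
    and "(\<Sum>a = 1..p. u a * M ^ a) = (\<Sum>a = 1..p. v a * M ^ a)"
  shows "\<forall>a\<in>{1..p}. u a = v a"
  using assms(1,2,4)
proof (induction p)
  case (Suc p)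
  let ?low = "\<lambda>u. \<Sum>a = 1..p. u a * M ^ a"
  have lt: "?low u < M ^ Suc p" "?low v < M ^ Suc p"
    using Suc.prems assms(3) by (intro sum_less_base_power; simp)+
  have eq: "?low u + u (Suc p) * M ^ Suc p = ?low v + v (Suc p) * M ^ Suc p"
    using Suc.prems(3) by simp
  have dm: "(s + c * P) div P = c" "(s + c * P) mod P = s" if "s < P" for s c P :: nat
    using that by auto
  have "?low u = ?low v" using dm(2)[OF lt(1)] dm(2)[OF lt(2)] eq by metis
  then have "\<forall>a\<in>{1..p}. u a = v a" using Suc.prems by (intro Suc.IH) simp_all
  moreover have "u (Suc p) = v (Suc p)" using dm(1)[OF lt(1)] dm(1)[OF lt(2)] eq by metis
  ultimately show ?case by (simp add: atLeastAtMostSuc_conv)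
qed simp

text \<open>If two polynomials in \<open>t 1, \<dots>, t p\<close> take the same values, then every linear functional takes the
  same value on both; the functional is given by its values \<open>h\<close> on monomials. The polynomials are
  families of terms in which exponents may be repeated, which avoids collecting terms on either side.
  Substituting \<open>t a = x\<^bsup>M^a\<^esup>\<close> with \<open>M\<close> larger than all exponents reduces the claim to polynomials in
  one variable over an infinite field.\<close>

lemma multivariate_coefficients_determined:
  fixes c :: "'i \<Rightarrow> 'a::field_char_0" and d :: "'j \<Rightarrow> 'a"
    and u :: "'i \<Rightarrow> nat \<Rightarrow> nat" and v :: "'j \<Rightarrow> nat \<Rightarrow> nat"
  assumes fin: "finite I" "finite J"
    and u0: "\<And>i a. i \<in> I \<Longrightarrow> a \<notin> {1..p} \<Longrightarrow> u i a = 0"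
    and v0: "\<And>j a. j \<in> J \<Longrightarrow> a \<notin> {1..p} \<Longrightarrow> v j a = 0"
    and eq: "\<And>t :: nat \<Rightarrow> 'a. (\<Sum>i\<in>I. c i * (\<Prod>a = 1..p. t a ^ u i a))
      = (\<Sum>j\<in>J. d j * (\<Prod>a = 1..p. t a ^ v j a))"
  shows "(\<Sum>i\<in>I. c i * h (u i)) = (\<Sum>j\<in>J. d j * h (v j))"
proof -
  define S where "S = u ` I \<union> v ` J"
  define M where "M = Suc (\<Sum>w\<in>S. \<Sum>a = 1..p. w a)"
  define code where "code w = (\<Sum>a = 1..p. w a * M ^ a)" for w :: "nat \<Rightarrow> nat"
  have finS: "finite S" using fin by (simp add: S_def)
  have less: "w a < M" if "w \<in> S" "a \<in> {1..p}" for w a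
  proof -
    have "w a \<le> (\<Sum>a = 1..p. w a)" using that by (intro member_le_sum) auto
    also have "\<dots> \<le> (\<Sum>w\<in>S. \<Sum>a = 1..p. w a)" using that finS by (intro member_le_sum) auto
    finally show ?thesis by (simp add: M_def)
  qed
  have inj: "inj_on code S"
  proof (rule inj_onI)
    fix w w' assume w: "w \<in> S" "w' \<in> S" "code w = code w'"
    have "w a = w' a" if "a \<in> {1..p}" for a
      using base_digits_unique[of p w M w'] w less that by (auto simp: code_def M_def)
    moreover have "w a = w' a" if "a \<notin> {1..p}" for a using w u0 v0 that unfolding S_def by fastforce
    ultimately show "w = w'" by blast
  qed
  have "poly (\<Sum>i\<in>I. monom (c i) (code (u i))) x = poly (\<Sum>j\<in>J. monom (d j) (code (v j))) x" for x
    using eq[of "\<lambda>a. x ^ (M ^ a)"]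
    by (simp add: poly_sum poly_monom code_def power_sum power_mult mult.commute[of _ "M ^ _"])
  then have polys: "(\<Sum>i\<in>I. monom (c i) (code (u i))) = (\<Sum>j\<in>J. monom (d j) (code (v j)))"
    using poly_eq_poly_eq_iff by blast
  \<comment> \<open>The functional on univariate polynomials that corresponds to \<open>h\<close>.\<close>
  define lin where "lin q = (\<Sum>w\<in>S. coeff q (code w) * h w)" for q :: "'a poly"
  have lin: "lin (\<Sum>k\<in>K. monom (e k) (code (w k))) = (\<Sum>k\<in>K. e k * h (w k))"
    if "w ` K \<subseteq> S" for K e and w :: "'k \<Rightarrow> nat \<Rightarrow> nat"
  proof -
    have "lin (\<Sum>k\<in>K. monom (e k) (code (w k)))
        = (\<Sum>k\<in>K. \<Sum>s\<in>S. (if code (w k) = code s then e k * h s else 0))"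
      unfolding lin_def coeff_sum sum_distrib_right
      by (subst sum.swap) (intro sum.cong refl, simp)
    also have "\<dots> = (\<Sum>k\<in>K. \<Sum>s\<in>S. (if w k = s then e k * h s else 0))"
      using that inj by (intro sum.cong refl) (auto dest: inj_onD)
    also have "\<dots> = (\<Sum>k\<in>K. e k * h (w k))"
      using that finS by (intro sum.cong refl) auto
    finally show ?thesis .
  qed
  show ?thesis using lin[of u I c] lin[of v J d] polys by (simp add: S_def)
qed

section \<open>The determinant as a polynomial in the block variables\<close>

text \<open>The matrix \<open>Z + T B\<close>, with \<open>Z\<close> the diagonal matrix of value \<open>z a\<close> on block \<open>a\<close>. It interpolates
  between \<open>A\<close> (for \<open>t = 1\<close>, when the diagonal blocks of \<open>A\<close> are the scalars \<open>z a\<close>) and \<open>1 + T B\<close> (for \<open>z = 1\<close>).\<close>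

definition scaled_blocks :: "(nat \<Rightarrow> nat) \<Rightarrow> 'a::comm_ring_1 mat \<Rightarrow> (nat \<Rightarrow> 'a) \<Rightarrow> (nat \<Rightarrow> 'a) \<Rightarrow> 'a mat" where
  "scaled_blocks ns A z t = mat (dim_row A) (dim_col A)
     (\<lambda>(i, j). (if i = j then z (block_index ns i) else 0) + scaled_offdiag ns A t $$ (i, j))"

definition moved_indices :: "(nat \<Rightarrow> nat) \<Rightarrow> nat \<Rightarrow> (nat \<Rightarrow> nat) \<Rightarrow> nat \<Rightarrow> nat" where
  "moved_indices ns n \<pi> a = card {i. i < n \<and> block_index ns i = a \<and> \<pi> i \<noteq> i}"

lemma card_block_index:
  assumes n: "n = (\<Sum>a = 1..p. ns a)" and a: "a \<in> {1..p}"
  shows "card {i. i < n \<and> block_index ns i = a} = ns a"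
proof -
  have "{i. i < n \<and> block_index ns i = a} = (\<lambda>i. block_offset ns a + i) ` {..<ns a}" (is "?B = ?O")
  proof
    show "?B \<subseteq> ?O"
    proof clarify
      fix l assume l: "l < n" and a: "a = block_index ns l"
      obtain b i where b: "b \<in> {1..p}" "i < ns b" "l = block_offset ns b + i"
        using block_index_cases l n by blast
      then have "block_index ns l = b" by (simp add: block_index_eq)
      then show "l \<in> (\<lambda>i. block_offset ns (block_index ns l) + i) ` {..<ns (block_index ns l)}"
        using b by simp
    qed
    show "?O \<subseteq> ?B" using a block_entry_bound[OF a] by (auto simp: n block_index_eq)
  qed
  then show ?thesis by (simp add: card_image)
qed

lemma block_index_range: "i < (\<Sum>a = 1..p. ns a) \<Longrightarrow> block_index ns i \<in> {1..p}"
  by (elim block_index_cases) (simp add: block_index_eq)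

lemma moved_indices_le:
  assumes "n = (\<Sum>a = 1..p. ns a)" "a \<in> {1..p}"
  shows "moved_indices ns n \<pi> a \<le> ns a"
  unfolding card_block_index[OF assms, symmetric] moved_indices_def by (rule card_mono) auto

lemma moved_indices_outside:
  assumes n: "n = (\<Sum>a = 1..p. ns a)" and a: "a \<notin> {1..p}"
  shows "moved_indices ns n \<pi> a = 0"
  using block_index_range[of _ ns p] a unfolding moved_indices_def n by (auto intro!: card_eq_0_iff[THEN iffD2])

text \<open>In the Leibniz expansion a fixed point of \<open>\<pi>\<close> in block \<open>a\<close> contributes \<open>z a\<close> and a moved index in
  block \<open>a\<close> contributes \<open>t a\<close> times an entry of \<open>B\<close>. So the determinant is homogeneous of degree \<open>ns a\<close>
  in \<open>z a\<close> and \<open>t a\<close> together, and the coefficients do not change between \<open>z = 1\<close> and \<open>t = 1\<close>.\<close>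

lemma det_scaled_blocks:
  fixes A :: "'a::comm_ring_1 mat"
  assumes A: "A \<in> carrier_mat n n" and n: "n = (\<Sum>a = 1..p. ns a)"
  shows "det (scaled_blocks ns A z t) = (\<Sum>\<pi>\<in>{\<pi>. \<pi> permutes {0..<n}}.
      signof \<pi> * (\<Prod>i\<in>{0..<n}. if \<pi> i = i then 1 else scaled_offdiag ns A (\<lambda>_. 1) $$ (i, \<pi> i))
      * (\<Prod>a = 1..p. z a ^ (ns a - moved_indices ns n \<pi> a) * t a ^ moved_indices ns n \<pi> a))"
proof -
  have S: "scaled_blocks ns A z t \<in> carrier_mat n n" using A by (auto simp: scaled_blocks_def)
  have "(\<Prod>i = 0..<n. scaled_blocks ns A z t $$ (i, \<pi> i))
      = (\<Prod>i\<in>{0..<n}. if \<pi> i = i then 1 else scaled_offdiag ns A (\<lambda>_. 1) $$ (i, \<pi> i))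
        * (\<Prod>a = 1..p. z a ^ (ns a - moved_indices ns n \<pi> a) * t a ^ moved_indices ns n \<pi> a)"
    if \<pi>: "\<pi> permutes {0..<n}" for \<pi>
  proof -
    have "(\<Prod>i = 0..<n. scaled_blocks ns A z t $$ (i, \<pi> i))
        = (\<Prod>i = 0..<n. (if \<pi> i = i then 1 else scaled_offdiag ns A (\<lambda>_. 1) $$ (i, \<pi> i))
            * (if \<pi> i = i then z (block_index ns i) else t (block_index ns i)))"
    proof (rule prod.cong[OF refl])
      fix i assume i: "i \<in> {0..<n}"
      then have "\<pi> i < n" using permutes_in_image[OF \<pi>, of i] by simp
      then show "scaled_blocks ns A z t $$ (i, \<pi> i)
          = (if \<pi> i = i then 1 else scaled_offdiag ns A (\<lambda>_. 1) $$ (i, \<pi> i))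
            * (if \<pi> i = i then z (block_index ns i) else t (block_index ns i))"
        using A i by (auto simp: scaled_blocks_def scaled_offdiag_def)
    qed
    also have "\<dots> = (\<Prod>i\<in>{0..<n}. if \<pi> i = i then 1 else scaled_offdiag ns A (\<lambda>_. 1) $$ (i, \<pi> i))
        * (\<Prod>i\<in>{0..<n}. if \<pi> i = i then z (block_index ns i) else t (block_index ns i))"
      by (rule prod.distrib)
    also have "(\<Prod>i\<in>{0..<n}. if \<pi> i = i then z (block_index ns i) else t (block_index ns i))
        = (\<Prod>a = 1..p. \<Prod>i\<in>{i \<in> {0..<n}. block_index ns i = a}.
            if \<pi> i = i then z (block_index ns i) else t (block_index ns i))"
      using block_index_range[of _ ns p] by (intro prod.group[symmetric]) (auto simp: n)
    also have "\<dots> = (\<Prod>a = 1..p. z a ^ (ns a - moved_indices ns n \<pi> a) * t a ^ moved_indices ns n \<pi> a)"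
    proof (rule prod.cong[OF refl])
      fix a assume a: "a \<in> {1..p}"
      let ?B = "{i. i < n \<and> block_index ns i = a}"
      let ?m = "{i. i < n \<and> block_index ns i = a \<and> \<pi> i \<noteq> i}"
      have B: "finite ?B" "?m \<subseteq> ?B" "?B \<inter> {i. \<pi> i = i} = ?B - ?m" "?B \<inter> - {i. \<pi> i = i} = ?m" by auto
      have "(\<Prod>i\<in>?B. if \<pi> i = i then z (block_index ns i) else t (block_index ns i))
          = (\<Prod>i\<in>?B. if \<pi> i = i then z a else t a)"
        by (rule prod.cong) auto
      also have "\<dots> = z a ^ card (?B - ?m) * t a ^ card ?m"
        unfolding prod.If_cases[OF B(1)] B(3,4) by (simp only: prod_constant)
      also have "card (?B - ?m) = ns a - card ?m"
        using B(1,2) card_block_index[OF n a] by (simp add: card_Diff_subset finite_subset)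
      finally show "(\<Prod>i\<in>{i \<in> {0..<n}. block_index ns i = a}.
            if \<pi> i = i then z (block_index ns i) else t (block_index ns i))
          = z a ^ (ns a - moved_indices ns n \<pi> a) * t a ^ moved_indices ns n \<pi> a"
        by (simp add: moved_indices_def)
    qed
    finally show ?thesis .
  qed
  then show ?thesis unfolding det_def'[OF S] by (intro sum.cong refl) (simp add: mult.assoc)
qed

lemma scaled_blocks_self:
  assumes A: "A \<in> carrier_mat n n" and n: "n = (\<Sum>a = 1..p. ns a)"
    and diag: "\<And>a. a \<in> {1..p} \<Longrightarrow> block ns A a a = z a \<cdot>\<^sub>m 1\<^sub>m (ns a)"
  shows "scaled_blocks ns A z (\<lambda>_. 1) = A"
proof (rule eq_matI)
  fix i j assume "i < dim_row A" "j < dim_col A"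
  then have ij: "i < n" "j < n" using A by auto
  obtain a k where a: "a \<in> {1..p}" "k < ns a" "i = block_offset ns a + k"
    using block_index_cases[of i ns p] ij n by blast
  obtain b l where b: "b \<in> {1..p}" "l < ns b" "j = block_offset ns b + l"
    using block_index_cases[of j ns p] ij n by blast
  have bi: "block_index ns i = a" "block_index ns j = b" using a b by (simp_all add: block_index_eq)
  have "A $$ (i, j) = (if i = j then z a else 0)" if "a = b"
  proof -
    have "A $$ (i, j) = block ns A a a $$ (k, l)" using a b that by (simp add: block_def)
    then show ?thesis using diag[OF a(1)] a b that by simp
  qed
  then show "scaled_blocks ns A z (\<lambda>_. 1) $$ (i, j) = A $$ (i, j)"
    using A ij bi by (auto simp: scaled_blocks_def scaled_offdiag_def)
qed (simp_all add: scaled_blocks_def)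

lemma scaled_blocks_ones:
  "A \<in> carrier_mat n n \<Longrightarrow> scaled_blocks ns A (\<lambda>_. 1) t = 1\<^sub>m n + scaled_offdiag ns A t"
  by (intro eq_matI) (auto simp: scaled_blocks_def scaled_offdiag_def)

section \<open>The expansion over multisets of cyclic walks\<close>

definition walk_weight :: "(nat \<Rightarrow> nat) \<Rightarrow> 'a::field_char_0 mat \<Rightarrow> nat list set \<Rightarrow> 'a" where
  "walk_weight ns A c = (-1) ^ (cyc_length c - 1) * cyc_trace ns A c / of_nat (cyc_val c)"

definition scaled_walk_weight ::
  "nat \<Rightarrow> (nat \<Rightarrow> nat) \<Rightarrow> 'a::field_char_0 mat \<Rightarrow> (nat \<Rightarrow> 'a) \<Rightarrow> nat list set \<Rightarrow> 'a" where
  "scaled_walk_weight p ns A t c = (\<Prod>a = 1..p. t a ^ cyc_visits c a) * walk_weight ns A c"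

text \<open>The identity \<open>det (1 + s X) = exp (Tr (log (1 + s X)))\<close> for \<open>X = T B\<close>, coefficient by coefficient:
  Newton's identities for the left side and the recursion for the exponential on the right side
  coincide, because \<open>Tr (X\<^sup>k)\<close> is a sum over closed walks of length \<open>k\<close>.\<close>

lemma minor_sum_eq_exp_coeff:
  fixes A :: "'a::field_char_0 mat"
  assumes A: "A \<in> carrier_mat n n" and n: "n = (\<Sum>a = 1..p. ns a)"
  shows "minor_sum (scaled_offdiag ns A t) N
    = exp_coeff (cyclic_walks p) cyc_length (scaled_walk_weight p ns A t) N"
proof (induction N rule: less_induct)
  case (less N)
  let ?X = "scaled_offdiag ns A t"
  let ?W = "cyclic_walks p"
  let ?w = "scaled_walk_weight p ns A t"
  have X: "?X \<in> carrier_mat n n" using A by (rule scaled_offdiag_carrier)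
  have pw: "(\<Sum>c\<in>{c \<in> ?W. cyc_length c = Suc j}. of_nat (cyc_length c) * ?w c)
      = (-1) ^ j * power_trace ?X (Suc j)" for j
  proof -
    let ?f = "\<lambda>c. (-1) ^ (cyc_length c - 1) * ((\<Prod>a = 1..p. t a ^ cyc_visits c a) * cyc_trace ns A c)"
    have "?w c = ?f c / of_nat (cyc_val c)" for c
      by (simp add: scaled_walk_weight_def walk_weight_def mult_ac)
    then have "(\<Sum>c\<in>{c \<in> ?W. cyc_length c = Suc j}. of_nat (cyc_length c) * ?w c)
        = (\<Sum>as\<in>{as \<in> closed_walks p. length as = Suc j}. ?f (cyc_orbit as))"
      by (simp only: sum_cyclic_walks_eq_sum_closed_walks)
    also have "\<dots> = (\<Sum>as\<in>{as \<in> closed_walks p. length as = Suc j}.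
        (-1) ^ j * ((\<Prod>a = 1..p. t a ^ count_list as a) * list_trace ns A as))"
      by (intro sum.cong refl)
        (auto simp: cyc_length_orbit cyc_visits_orbit cyc_trace_orbit dest!: closed_walks_nonempty)
    finally show ?thesis
      by (simp only: power_trace_scaled_offdiag[OF A n] sum_distrib_left)
  qed
  have rec: "of_nat N * exp_coeff ?W cyc_length ?w N
      = (\<Sum>j<N. (-1) ^ j * power_trace ?X (Suc j) * exp_coeff ?W cyc_length ?w (N - Suc j))"
    unfolding pw[symmetric]
    by (rule exp_coeff_recursion) (erule cyc_length_pos, rule finite_cyclic_walks_of_length)
  show ?case
  proof (cases "N = 0")
    case True
    then show ?thesis using minor_sum_0[OF X] exp_coeff_0[of ?W cyc_length ?w, OF cyc_length_pos] by simp
  next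
    case False
    have "of_nat N * minor_sum ?X N = of_nat N * exp_coeff ?W cyc_length ?w N"
      unfolding newton_identity[OF X] rec using less.IH by (intro sum.cong refl) simp
    then show ?thesis using False by simp
  qed
qed

lemma mset_weight_scaled:
  "mset_weight (scaled_walk_weight p ns A t) C
    = mset_weight (walk_weight ns A) C * (\<Prod>a = 1..p. t a ^ mset_visits C a)"
proof -
  have "(\<Prod>c\<in>#C. scaled_walk_weight p ns A t c)
      = (\<Prod>c\<in>#C. walk_weight ns A c) * (\<Prod>a = 1..p. t a ^ mset_visits C a)"
    by (induction C) (simp_all add: mset_visits_def scaled_walk_weight_def power_add prod.distrib mult_ac)
  then show ?thesis by (simp add: mset_weight_def)
qed

lemma mset_visits_outside:
  assumes "set_mset C \<subseteq> cyclic_walks p" "a \<notin> {1..p}"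
  shows "mset_visits C a = 0"
proof -
  have "cyc_visits c a = 0" if "c \<in># C" for c
  proof -
    obtain as where as: "as \<in> closed_walks p" "c = cyc_orbit as"
      using assms(1) \<open>c \<in># C\<close> by (auto simp: cyclic_walks_def)
    then have "a \<notin> set as" using assms(2) by (auto simp: closed_walks_def)
    then show ?thesis using as by (simp add: cyc_visits_orbit closed_walks_nonempty)
  qed
  then show ?thesis by (simp add: mset_visits_def)
qed

lemma total_length_eq_sum_visits:
  assumes "set_mset C \<subseteq> cyclic_walks p"
  shows "total_length cyc_length C = (\<Sum>a = 1..p. mset_visits C a)"
  using assms
  by (induction C) (auto simp: total_length_def mset_visits_def sum.distrib cyc_length_eq_sum_visits)

theorem theorem1p3:
  fixes p :: nat and ns :: "nat \<Rightarrow> nat" and n :: nat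
    and A :: "'a::field_char_0 mat" and z :: "nat \<Rightarrow> 'a"
  assumes "p \<ge> 1"
    and "\<And>a. a \<in> {1..p} \<Longrightarrow> ns a \<ge> 1"
    and "n = (\<Sum>a = 1..p. ns a)"
    and "A \<in> carrier_mat n n"
    and "\<And>a. a \<in> {1..p} \<Longrightarrow> block ns A a a = z a \<cdot>\<^sub>m 1\<^sub>m (ns a)"
  shows "det A =
    (\<Sum>C \<in> walk_msets p ns.
       (\<Prod>a = 1..p. z a ^ (ns a - mset_visits C a)) / of_nat (mset_fact C)
       * (\<Prod>c\<in>#C. (-1) ^ (cyc_length c - 1) * cyc_trace ns A c / of_nat (cyc_val c)))"
proof -
  note n = assms(3) and A = assms(4)
  let ?P = "{\<pi>. \<pi> permutes {0..<n}}"
  let ?E = "\<lambda>\<pi>. signof \<pi> * (\<Prod>i\<in>{0..<n}. if \<pi> i = i then 1 else scaled_offdiag ns A (\<lambda>_. 1) $$ (i, \<pi> i))"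
  let ?K = "\<Union>N\<le>n. msets_of_length (cyclic_walks p) cyc_length N"
  let ?w = "mset_weight (walk_weight ns A)"
  \<comment> \<open>The functional \<open>h\<close> turns a monomial in \<open>t\<close> into the complementary monomial in \<open>z\<close>; it kills
    the monomials with some exponent above \<open>ns a\<close>, which never occur in the
    determinant but do occur in individual multisets of walks.\<close>
  define h where "h v = (if \<forall>a\<in>{1..p}. v a \<le> ns a then \<Prod>a = 1..p. z a ^ (ns a - v a) else 0)"
    for v :: "nat \<Rightarrow> nat"
  have finK: "finite (msets_of_length (cyclic_walks p) cyc_length N)" for N
    by (rule finite_msets_of_length[OF cyc_length_pos finite_cyclic_walks_of_length])
  have "(\<Sum>\<pi>\<in>?P. ?E \<pi> * (\<Prod>a = 1..p. t a ^ moved_indices ns n \<pi> a))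
      = (\<Sum>C\<in>?K. ?w C * (\<Prod>a = 1..p. t a ^ mset_visits C a))" for t
  proof -
    have "(\<Sum>\<pi>\<in>?P. ?E \<pi> * (\<Prod>a = 1..p. t a ^ moved_indices ns n \<pi> a))
        = det (1\<^sub>m n + scaled_offdiag ns A t)"
      by (simp add: det_scaled_blocks[OF A n] flip: scaled_blocks_ones[OF A])
    also have "\<dots> = (\<Sum>N\<le>n. exp_coeff (cyclic_walks p) cyc_length (scaled_walk_weight p ns A t) N)"
      by (simp add: det_one_plus_eq_minor_sums[OF scaled_offdiag_carrier[OF A]] minor_sum_eq_exp_coeff[OF A n])
    also have "\<dots> = (\<Sum>C\<in>?K. mset_weight (scaled_walk_weight p ns A t) C)"
      unfolding exp_coeff_def using finK
      by (intro sum.UNION_disjoint[symmetric]) (auto simp: msets_of_length_def)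
    finally show ?thesis by (simp only: mset_weight_scaled)
  qed
  then have "(\<Sum>\<pi>\<in>?P. ?E \<pi> * h (moved_indices ns n \<pi>)) = (\<Sum>C\<in>?K. ?w C * h (mset_visits C))"
  proof (rule multivariate_coefficients_determined[where p = p and c = ?E and d = ?w, rotated 4])
    show "finite ?P" by (simp add: finite_permutations)
    show "finite ?K" using finK by simp
    show "moved_indices ns n \<pi> a = 0" if "a \<notin> {1..p}" for \<pi> a
      using n that by (rule moved_indices_outside)
    show "mset_visits C a = 0" if "C \<in> ?K" "a \<notin> {1..p}" for C a
      using that mset_visits_outside[of C p a] by (auto simp: msets_of_length_def)
  qed
  moreover have "det A = (\<Sum>\<pi>\<in>?P. ?E \<pi> * h (moved_indices ns n \<pi>))"
  proof -
    have "det A = det (scaled_blocks ns A z (\<lambda>_. 1))"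
      by (simp only: scaled_blocks_self[OF A n assms(5)])
    also have "\<dots> = (\<Sum>\<pi>\<in>?P. ?E \<pi> * h (moved_indices ns n \<pi>))"
      by (simp add: det_scaled_blocks[OF A n] h_def moved_indices_le[OF n])
    finally show ?thesis .
  qed
  moreover have "(\<Sum>C\<in>?K. ?w C * h (mset_visits C)) = (\<Sum>C\<in>walk_msets p ns. ?w C * h (mset_visits C))"
  proof (rule sum.mono_neutral_right)
    show "walk_msets p ns \<subseteq> ?K"
    proof
      fix C assume C: "C \<in> walk_msets p ns"
      have "(\<Sum>a = 1..p. mset_visits C a) \<le> n"
        unfolding n using C by (intro sum_mono) (simp add: walk_msets_def)
      then show "C \<in> ?K" using C
        by (auto simp: walk_msets_def msets_of_length_def total_length_eq_sum_visits[where p = p])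
    qed
    show "\<forall>C\<in>?K - walk_msets p ns. ?w C * h (mset_visits C) = 0"
      by (auto simp: walk_msets_def msets_of_length_def h_def)
  qed (use finK in auto)
  moreover have "?w C * h (mset_visits C) = (\<Prod>a = 1..p. z a ^ (ns a - mset_visits C a)) / of_nat (mset_fact C)
       * (\<Prod>c\<in>#C. (-1) ^ (cyc_length c - 1) * cyc_trace ns A c / of_nat (cyc_val c))"
    if "C \<in> walk_msets p ns" for C
    using that by (simp add: walk_msets_def h_def mset_weight_def walk_weight_def mult.commute)
  ultimately show ?thesis by simp
qed

end
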